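(* Let $X\in\mathbb R^{p_1\times\cdots\times p_K\times n}$ follow the mean-zero array normal model with parameter $\Sigma^{1/2}=(\sigma,\Psi_1,\dots,\Psi_K)\in\mathcal G_{\mathbf p}^+$, that is, $$X\sim N_{p_1\times\cdots\times p_K\times n}\bigl(0,\ \sigma^2(I_n\otimes\Psi_K\Psi_K^T\otimes\cdots\otimes\Psi_1\Psi_1^T)\bigr).$$ Let $L:\mathcal G_{\mathbf p}^+\times\mathcal G_{\mathbf p}^+\to\mathbb R^+$ be an invariant loss function, i.e. $L(\Sigma^{1/2},B)=L(A\Sigma^{1/2},AB)$ for all $A,B,\Sigma^{1/2}\in\mathcal G_{\mathbf p}^+$. Then the estimator $\hat\Sigma^{1/2}$ defined by $$\hat\Sigma^{1/2}(X)=\operatorname*{arg\,min}_{B\in\mathcal G_{\mathbf p}^+}\ \mathrm E[L(\Sigma^{1/2},B)\mid X]$$ uniformly (in $\Sigma^{1/2}$) minimizes the risk $\mathrm E[L(\Sigma^{1/2},\tilde\Sigma^{1/2}(X))\mid\Sigma^{1/2}]$ among equivariant estimators $\tilde\Sigma^{1/2}$ of $\Sigma^{1/2}$. Here the expectation in the definition of $\hat\Sigma^{1/2}(X)$ is with respect to the posterior density $$p(\sigma,\Psi_1,\dots,\Psi_K\mid X)\ \propto\ \sigma^{-np}\exp\left\{-\frac1{2\sigma^2}\bigl\|X\times\{\Psi_1^{-1},\dots,\Psi_K^{-1},I_n\}\bigr\|^2\right\}\ \frac1\sigma\prod_{k=1}^K\prod_{i=2}^{p_k}\Psi_{k[i,i]}^{\,i-2},$$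 where $p=\prod_{k=1}^Kp_k$.
   Context: $\mathcal G_q^+$ is the group of $q\times q$ real lower triangular matrices with positive diagonal entries and determinant $1$; $\mathcal G_{\mathbf p}^+=\{(a,A_1,\dots,A_K):a>0,\ A_k\in\mathcal G_{p_k}^+\}$ with componentwise multiplication. The Tucker product $Z\times\{A_1,\dots,A_m\}$ of an $m$-way array $Z$ with matrices is defined by $\mathrm{vec}(Z\times\{A_1,\dots,A_m\})=(A_m\otimes\cdots\otimes A_1)\mathrm{vec}(Z)$; $\|\cdot\|$ is the Frobenius norm of an array (square root of the sum of squared entries). $X\sim N_{p_1\times\cdots\times p_K\times n}(0,\Omega)$ means $\mathrm{vec}(X)$ is multivariate normal with mean $0$ and covariance $\Omega$. The group acts on the sample space by $X\mapsto aX\times\{A_1,\dots,A_K,I_n\}$, and on the parameter space (which is the group itself) by $\Sigma^{1/2}\mapsto A\Sigma^{1/2}=(a\sigma,A_1\Psi_1,\dots,A_K\Psi_K)$. An estimator $\tilde\Sigma^{1/2}:\mathbb R^{p_1\times\cdots\times p_K\times n}\to\mathcal G_{\mathbf p}^+$ is equivariant if $\tilde\Sigma^{1/2}(aX\times\{A_1,\dots,A_K,I_n\})=(a,A_1,\dots,A_K)\,\tilde\Sigma^{1/2}(X)$ for all $(a,A_1,\dots,A_K)\in\mathcal G_{\mathbf p}^+$ and all $X$. $\Psi_{k[i,j]}$ is the $(i,j)$ entry of $\Psi_k$. The posterior density is with respect to Lebesgue measure in the coordinates $\sigma>0$ and $\{\Psi_{k[i,j]}:2\le i\le p_k,1\le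 j\le i\}$ for each $k$ (with $\Psi_{k[i,i]}>0$), where $\Psi_{k[1,1]}=\prod_{i=2}^{p_k}\Psi_{k[i,i]}^{-1}$.
   Formalization: Equivariance is required, for each group element, only for almost every X (at X=0 it is impossible), and the arg min is taken for almost every X; the minimizer is assumed unique for almost every X, or else ties are broken equivariantly, since arbitrary tie-breaking can fail. *)

theory Defs
  imports
    "HOL-Probability.Probability"
    "Jordan_Normal_Form.Gauss_Jordan_Elimination"
    "Jordan_Normal_Form.Determinant"
begin

section \<open>Arrays, vectorization and the Tucker product\<close>

text \<open>
  Matrices are those of Jordan_Normal_Form. All indices start at 0. An array with dimensions
  \<open>d = [d_1, ..., d_m]\<close> is a function on multi-indices that is \<open>undefined\<close> outside
  \<open>array_index d\<close>, that is, an element of \<open>array_index d \<rightarrow>\<^sub>E UNIV\<close>.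
\<close>

type_synonym array = "nat list \<Rightarrow> real"

definition array_index :: "nat list \<Rightarrow> nat list set" where
  "array_index d = {is. list_all2 (<) is d}"

text \<open>
  The position of an entry in the vectorization is column-major (the first index varies
  fastest), which is the convention that goes with the order of the factors in
  \<open>A_m \<otimes> ... \<otimes> A_1\<close>; \<open>multi_index d\<close> is the inverse of \<open>vec_pos d\<close>.
\<close>

fun vec_pos :: "nat list \<Rightarrow> nat list \<Rightarrow> nat" where
  "vec_pos (d # ds) (i # is) = i + d * vec_pos ds is"
| "vec_pos _ _ = 0"

fun multi_index :: "nat list \<Rightarrow> nat \<Rightarrow> nat list" where
  "multi_index [] t = []"
| "multi_index (d # ds) t = (t mod d) # multi_index ds (t div d)"

definition array_vec :: "nat list \<Rightarrow> array \<Rightarrow> real Matrix.vec" where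
  "array_vec d Z = Matrix.vec (prod_list d) (\<lambda>t. Z (multi_index d t))"

definition array_of_vec :: "nat list \<Rightarrow> real Matrix.vec \<Rightarrow> array" where
  "array_of_vec d v = (\<lambda>is\<in>array_index d. vec_index v (vec_pos d is))"

definition kronecker :: "real mat \<Rightarrow> real mat \<Rightarrow> real mat" where
  "kronecker A B = mat (dim_row A * dim_row B) (dim_col A * dim_col B)
     (\<lambda>(i, j). A $$ (i div dim_row B, j div dim_col B) * B $$ (i mod dim_row B, j mod dim_col B))"

text \<open>\<open>rev_kronecker [A_1, ..., A_m]\<close> is \<open>A_m \<otimes> ... \<otimes> A_1\<close>.\<close>

fun rev_kronecker :: "real mat list \<Rightarrow> real mat" where
  "rev_kronecker [] = 1\<^sub>m 1"
| "rev_kronecker (A # As) = kronecker (rev_kronecker As) A"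

definition tucker :: "array \<Rightarrow> real mat list \<Rightarrow> array" where
  "tucker Z As = array_of_vec (map dim_row As)
     (rev_kronecker As *\<^sub>v array_vec (map dim_col As) Z)"

definition array_scale :: "nat list \<Rightarrow> real \<Rightarrow> array \<Rightarrow> array" where
  "array_scale d a Z = (\<lambda>is\<in>array_index d. a * Z is)"

definition frob_norm :: "nat list \<Rightarrow> array \<Rightarrow> real" where
  "frob_norm d Z = sqrt (\<Sum>is\<in>array_index d. (Z is)\<^sup>2)"

definition mat_inv :: "real mat \<Rightarrow> real mat" where
  "mat_inv A = the (mat_inverse A)"

section \<open>The group\<close>

definition lower_tri_group :: "nat \<Rightarrow> real mat set" where
  "lower_tri_group q = {A \<in> carrier_mat q q.
     (\<forall>i<q. \<forall>j<q. i < j \<longrightarrow> A $$ (i, j) = 0) \<and> (\<forall>i<q. 0 < A $$ (i, i)) \<and> Determinant.det A = 1}"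

type_synonym param = "real \<times> real mat list"

definition param_group :: "nat list \<Rightarrow> param set" where
  "param_group p = {(a, As). 0 < a \<and> list_all2 (\<lambda>A q. A \<in> lower_tri_group q) As p}"

definition param_mult :: "param \<Rightarrow> param \<Rightarrow> param" where
  "param_mult S T = (fst S * fst T, map2 (*) (snd S) (snd T))"

text \<open>The action of the group on arrays with dimensions \<open>[p_1, ..., p_K, n]\<close>\<close>

definition array_act :: "nat list \<Rightarrow> nat \<Rightarrow> param \<Rightarrow> array \<Rightarrow> array" where
  "array_act p n A X = tucker (array_scale (p @ [n]) (fst A) X) (snd A @ [1\<^sub>m n])"

section \<open>Measures\<close>

definition array_lebesgue :: "nat list \<Rightarrow> array measure" where
  "array_lebesgue d = PiM (array_index d) (\<lambda>_. lborel)"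

text \<open>
  The group as a measurable space, with the Borel sets it inherits as a subset of Euclidean space
  (scale and all matrix entries).
\<close>

definition entry_index :: "nat list \<Rightarrow> (nat \<times> nat \<times> nat) set" where
  "entry_index p = {(k, i, j). k < length p \<and> i < p ! k \<and> j < p ! k}"

definition param_entries :: "nat list \<Rightarrow> param \<Rightarrow> real \<times> (nat \<times> nat \<times> nat \<Rightarrow> real)" where
  "param_entries p S = (fst S, \<lambda>(k, i, j)\<in>entry_index p. (snd S ! k) $$ (i, j))"

definition param_borel :: "nat list \<Rightarrow> param measure" where
  "param_borel p = vimage_algebra (param_group p) (param_entries p)
     (borel \<Otimes>\<^sub>M PiM (entry_index p) (\<lambda>_. borel))"

text \<open>
  Lebesgue measure on the group in the coordinates \<open>\<sigma>\<close> and \<open>\<Psi>_k[i,j]\<close> with \<open>j \<le> i\<close>, the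
  first row of each matrix excluded: it is transported from the coordinate domain along
  \<open>param_of_coords\<close>, which fills in the remaining entries of the matrices.
\<close>

definition coord_index :: "nat list \<Rightarrow> (nat \<times> nat \<times> nat) set" where
  "coord_index p = {(k, i, j). k < length p \<and> 1 \<le> i \<and> i < p ! k \<and> j \<le> i}"

definition coord_domain :: "nat list \<Rightarrow> (real \<times> (nat \<times> nat \<times> nat \<Rightarrow> real)) set" where
  "coord_domain p = {(s, c). 0 < s \<and> c \<in> extensional (coord_index p)
     \<and> (\<forall>k i. (k, i, i) \<in> coord_index p \<longrightarrow> 0 < c (k, i, i))}"

definition param_of_coords :: "nat list \<Rightarrow> real \<times> (nat \<times> nat \<times> nat \<Rightarrow> real) \<Rightarrow> param" where
  "param_of_coords p = (\<lambda>(s, c). (s, map (\<lambda>k. mat (p ! k) (p ! k) (\<lambda>(i, j).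
       if i = 0 \<and> j = 0 then \<Prod>l\<in>{1..<p ! k}. inverse (c (k, l, l))
       else if j \<le> i then c (k, i, j) else 0)) [0..<length p]))"

definition param_lebesgue :: "nat list \<Rightarrow> param measure" where
  "param_lebesgue p = distr
     (restrict_space (lborel \<Otimes>\<^sub>M PiM (coord_index p) (\<lambda>_. lborel)) (coord_domain p))
     (param_borel p) (param_of_coords p)"

section \<open>The array normal model\<close>

text \<open>Density of the centred multivariate normal distribution with nonsingular covariance matrix\<close>

definition mvn_density :: "real mat \<Rightarrow> real Matrix.vec \<Rightarrow> real" where
  "mvn_density \<Omega> x = exp (- (x \<bullet> (mat_inv \<Omega> *\<^sub>v x)) / 2) / sqrt ((2 * pi) ^ dim_row \<Omega> * Determinant.det \<Omega>)"

text \<open>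
  Since \<open>array_vec\<close> only relabels the coordinates, the law of an array whose vectorization is
  normal has the normal density of the vectorization with respect to \<open>array_lebesgue\<close>.
\<close>

definition array_normal :: "nat list \<Rightarrow> real mat \<Rightarrow> array measure" where
  "array_normal d \<Omega> = density (array_lebesgue d) (\<lambda>X. ennreal (mvn_density \<Omega> (array_vec d X)))"

definition model_cov :: "nat \<Rightarrow> param \<Rightarrow> real mat" where
  "model_cov n S = (fst S)\<^sup>2 \<cdot>\<^sub>m rev_kronecker (map (\<lambda>\<Psi>. \<Psi> * \<Psi>\<^sup>T) (snd S) @ [1\<^sub>m n])"

definition model :: "nat list \<Rightarrow> nat \<Rightarrow> param \<Rightarrow> array measure" where
  "model p n S = array_normal (p @ [n]) (model_cov n S)"

section \<open>Estimators, risk and posterior\<close>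

definition estimator :: "nat list \<Rightarrow> nat \<Rightarrow> (array \<Rightarrow> param) \<Rightarrow> bool" where
  "estimator p n \<delta> \<longleftrightarrow> \<delta> \<in> array_lebesgue (p @ [n]) \<rightarrow>\<^sub>M param_borel p"

text \<open>
  Equivariance is required for every group element at almost every array. It cannot hold at
  every array: the zero array is fixed by the whole group, while the group acts freely on itself.
\<close>

definition equivariant :: "nat list \<Rightarrow> nat \<Rightarrow> (array \<Rightarrow> param) \<Rightarrow> bool" where
  "equivariant p n \<delta> \<longleftrightarrow> (\<forall>A\<in>param_group p. AE X in array_lebesgue (p @ [n]).
     \<delta> (array_act p n A X) = param_mult A (\<delta> X))"

definition invariant_loss :: "nat list \<Rightarrow> (param \<Rightarrow> param \<Rightarrow> real) \<Rightarrow> bool" where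
  "invariant_loss p L \<longleftrightarrow>
     (\<lambda>(S, B). L S B) \<in> borel_measurable (param_borel p \<Otimes>\<^sub>M param_borel p) \<and>
     (\<forall>S\<in>param_group p. \<forall>B\<in>param_group p. 0 \<le> L S B) \<and>
     (\<forall>A\<in>param_group p. \<forall>S\<in>param_group p. \<forall>B\<in>param_group p.
        L S B = L (param_mult A S) (param_mult A B))"

definition risk :: "nat list \<Rightarrow> nat \<Rightarrow> (param \<Rightarrow> param \<Rightarrow> real) \<Rightarrow> param \<Rightarrow> (array \<Rightarrow> param) \<Rightarrow> ennreal"
  where "risk p n L S \<delta> = (\<integral>\<^sup>+ X. ennreal (L S (\<delta> X)) \<partial>model p n S)"

text \<open>
  With rows counted from 0, the exponent \<open>i - 2\<close> of the diagonal entry in row \<open>i \<ge> 2\<close> becomes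
  \<open>i - 1\<close> with \<open>i \<ge> 1\<close>.
\<close>

definition posterior_kernel :: "nat list \<Rightarrow> nat \<Rightarrow> array \<Rightarrow> param \<Rightarrow> real" where
  "posterior_kernel p n X = (\<lambda>(\<sigma>, \<Psi>).
     inverse \<sigma> ^ (n * prod_list p)
     * exp (- (1 / (2 * \<sigma>\<^sup>2)) * (frob_norm (p @ [n]) (tucker X (map mat_inv \<Psi> @ [1\<^sub>m n])))\<^sup>2)
     * (1 / \<sigma>) * (\<Prod>k<length p. \<Prod>i\<in>{1..<p ! k}. ((\<Psi> ! k) $$ (i, i)) ^ (i - 1)))"

text \<open>
  If the kernel is not integrable, the normalizing constant is infinite and the posterior is the
  zero measure, so that every point minimizes the posterior expected loss: a unique minimizer
  exists only where the posterior is proper.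
\<close>

definition posterior :: "nat list \<Rightarrow> nat \<Rightarrow> array \<Rightarrow> param measure" where
  "posterior p n X = density (param_lebesgue p) (\<lambda>S. ennreal (posterior_kernel p n X S)
     / (\<integral>\<^sup>+ T. ennreal (posterior_kernel p n X T) \<partial>param_lebesgue p))"

definition posterior_loss :: "nat list \<Rightarrow> nat \<Rightarrow> (param \<Rightarrow> param \<Rightarrow> real) \<Rightarrow> array \<Rightarrow> param \<Rightarrow> ennreal"
  where "posterior_loss p n L X B = (\<integral>\<^sup>+ S. ennreal (L S B) \<partial>posterior p n X)"

definition posterior_argmin :: "nat list \<Rightarrow> nat \<Rightarrow> (param \<Rightarrow> param \<Rightarrow> real) \<Rightarrow> array \<Rightarrow> param set" where
  "posterior_argmin p n L X =
     {B. is_arg_min (posterior_loss p n L X) (\<lambda>B. B \<in> param_group p) B}"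

end

theory Submission
  imports Defs
begin

text \<open>
  The prior is the right Haar measure \<open>\<nu>\<close> of the group, because right translations are triangular
  linear maps in the coordinates; left translations only rescale it. The likelihood \<open>f\<close> satisfies
  \<open>f (A S) (A X) = a\<^sup>-\<^sup>N f S X\<close>, where \<open>a\<close> is the scale of \<open>A\<close> and \<open>a\<^sup>N\<close> is the factor by
  which \<open>A\<close> changes Lebesgue measure on the arrays. Hence the posterior at \<open>A X\<close> is the translate of
  the posterior at \<open>X\<close>, and a unique posterior minimizer is equivariant.

  For optimality no decomposition of the sample space into orbits is needed. Let \<open>\<delta>\<^sub>0\<close> be the
  equivariant posterior minimizer and \<open>\<phi> > 0\<close> a \<open>\<nu>\<close>-integrable function on the group.
  For equivariant \<open>\<delta>\<close>, Fubini, the substitution \<open>X = S Y\<close> and right invariance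
  (which makes \<open>\<integral> \<phi> (S \<delta>\<^sub>0(Y)) d\<nu>(S)\<close> independent of \<open>Y\<close>) give, up to the constant of the normal
  density,
  \<open>(\<integral> \<phi> d\<nu>) * risk \<delta> = \<integral> \<phi> (\<delta>\<^sub>0 X) (\<integral> L S (\<delta> X) f S X d\<nu>(S)) dX\<close>.
  The constant loss 1 shows that the posterior is proper at almost every \<open>X\<close>; then \<open>\<delta>\<^sub>0\<close> minimizes the
  right-hand side pointwise.
\<close>

section \<open>Kronecker products and triangular matrices\<close>

lemma bij_betw_div_mod:
  fixes a b :: nat
  shows "bij_betw (\<lambda>t. (t div b, t mod b)) {..<a * b} ({..<a} \<times> {..<b})"
proof (rule bij_betw_byWitness[where f' = "\<lambda>(u, v). u * b + v"])
  show "(\<lambda>t. (t div b, t mod b)) ` {..<a * b} \<subseteq> {..<a} \<times> {..<b}"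
  proof clarsimp
    fix t assume "t < a * b"
    moreover from this have "0 < b" by (cases b) auto
    ultimately show "t div b < a \<and> t mod b < b" by (simp add: less_mult_imp_div_less)
  qed
  show "(\<lambda>(u, v). u * b + v) ` ({..<a} \<times> {..<b}) \<subseteq> {..<a * b}"
  proof clarsimp
    fix u v assume "u < a" "v < b"
    then have "u * b + v < (u + 1) * b" by simp
    also have "\<dots> \<le> a * b" using \<open>u < a\<close> by (intro mult_right_mono) auto
    finally show "u * b + v < a * b" .
  qed
qed auto

lemma sum_div_mod:
  fixes a b :: nat and f :: "nat \<Rightarrow> nat \<Rightarrow> 'a::comm_monoid_add"
  shows "(\<Sum>t<a * b. f (t div b) (t mod b)) = (\<Sum>u<a. \<Sum>v<b. f u v)"
  using sum.reindex_bij_betw[OF bij_betw_div_mod, of "\<lambda>(u, v). f u v" b a]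
  by (simp add: sum.cartesian_product)

lemma prod_div_mod:
  fixes a b :: nat and f :: "nat \<Rightarrow> nat \<Rightarrow> 'a::comm_monoid_mult"
  shows "(\<Prod>t<a * b. f (t div b) (t mod b)) = (\<Prod>u<a. \<Prod>v<b. f u v)"
  using prod.reindex_bij_betw[OF bij_betw_div_mod, of "\<lambda>(u, v). f u v" b a]
  by (simp add: prod.cartesian_product)

lemma div_mod_less_mult:
  fixes t a b :: nat
  assumes "t < a * b"
  shows "t div b < a" "t mod b < b"
proof -
  from assms have "0 < b" by (cases b) auto
  with assms show "t div b < a" "t mod b < b" by (simp_all add: less_mult_imp_div_less)
qed

lemma array_index_Nil [simp]: "array_index [] = {[]}"
  by (auto simp: array_index_def)

lemma array_index_Cons:
  "is \<in> array_index (q # d) \<longleftrightarrow> (\<exists>i js. is = i # js \<and> i < q \<and> js \<in> array_index d)"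
  by (auto simp: array_index_def list_all2_Cons2)

lemma vec_pos_less: "is \<in> array_index d \<Longrightarrow> vec_pos d is < prod_list d"
proof (induction d arbitrary: "is")
  case (Cons q d)
  then obtain i js where *: "is = i # js" "i < q" "js \<in> array_index d"
    by (auto simp: array_index_Cons)
  have "i + q * vec_pos d js < q * (vec_pos d js + 1)" using * by simp
  also have "\<dots> \<le> q * prod_list d" using Cons.IH[OF *(3)] by (intro mult_left_mono) auto
  finally show ?case using * by simp
qed simp

lemma multi_index_vec_pos: "is \<in> array_index d \<Longrightarrow> multi_index d (vec_pos d is) = is"
  by (induction d arbitrary: "is") (auto simp: array_index_Cons)

lemma multi_index_in: "t < prod_list d \<Longrightarrow> multi_index d t \<in> array_index d"
proof (induction d arbitrary: t)
  case (Cons q d)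
  then have "t < prod_list d * q" by (simp add: mult.commute)
  from Cons.IH[OF div_mod_less_mult(1)[OF this]] div_mod_less_mult(2)[OF this]
  show ?case by (auto simp: array_index_Cons)
qed simp

lemma vec_pos_multi_index: "t < prod_list d \<Longrightarrow> vec_pos d (multi_index d t) = t"
proof (induction d arbitrary: t)
  case (Cons q d)
  then have "t < prod_list d * q" by (simp add: mult.commute)
  from Cons.IH[OF div_mod_less_mult(1)[OF this]] show ?case by simp
qed simp

lemma bij_betw_vec_pos: "bij_betw (vec_pos d) (array_index d) {..<prod_list d}"
  by (rule bij_betw_byWitness[where f' = "multi_index d"])
    (auto simp: multi_index_vec_pos vec_pos_multi_index vec_pos_less multi_index_in)

lemma finite_array_index [simp]: "finite (array_index d)"
  using bij_betw_finite[OF bij_betw_vec_pos[of d]] by simp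

lemma array_vec_carrier [simp]: "array_vec d Z \<in> carrier_vec (prod_list d)"
  by (simp add: array_vec_def)

lemma array_vec_of_vec:
  "v \<in> carrier_vec (prod_list d) \<Longrightarrow> array_vec d (array_of_vec d v) = v"
  by (intro eq_vecI)
    (auto simp: array_vec_def array_of_vec_def multi_index_in vec_pos_multi_index)

lemma frob_norm_sq:
  "(frob_norm d Z)\<^sup>2 = scalar_prod (array_vec d Z) (array_vec d Z)"
proof -
  have "scalar_prod (array_vec d Z) (array_vec d Z)
      = (\<Sum>t<prod_list d. (Z (multi_index d t))\<^sup>2)"
    by (simp add: scalar_prod_def array_vec_def power2_eq_square lessThan_atLeast0)
  also have "\<dots> = (\<Sum>is\<in>array_index d. (Z is)\<^sup>2)"
    by (subst sum.reindex_bij_betw[OF bij_betw_vec_pos[of d], symmetric])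
      (auto intro!: sum.cong simp: multi_index_vec_pos)
  finally show ?thesis
    by (simp add: frob_norm_def sum_nonneg)
qed

lemma kronecker_carrier [simp]:
  "A \<in> carrier_mat a b \<Longrightarrow> B \<in> carrier_mat c d \<Longrightarrow> kronecker A B \<in> carrier_mat (a * c) (b * d)"
  by (auto simp: kronecker_def)

lemma kronecker_index:
  assumes "A \<in> carrier_mat a b" "B \<in> carrier_mat c d" "i < a * c" "j < b * d"
  shows "kronecker A B $$ (i, j) = A $$ (i div c, j div d) * B $$ (i mod c, j mod d)"
  using assms by (auto simp: kronecker_def)

lemma mult_mat_index:
  assumes "A \<in> carrier_mat a b" "B \<in> carrier_mat b c" "i < a" "j < c"
  shows "(A * B) $$ (i, j) = (\<Sum>k<b. A $$ (i, k) * B $$ (k, j))"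
  using assms by (auto simp: scalar_prod_def lessThan_atLeast0 intro!: sum.cong)

lemma kronecker_mult:
  assumes A: "A \<in> carrier_mat a b" and C: "C \<in> carrier_mat b c"
    and B: "B \<in> carrier_mat a' b'" and D: "D \<in> carrier_mat b' c'"
  shows "kronecker A B * kronecker C D = kronecker (A * C) (B * D)" (is "?l = ?r")
proof (rule eq_matI)
  have AC: "A * C \<in> carrier_mat a c" and BD: "B * D \<in> carrier_mat a' c'" using assms by auto
  note kr = kronecker_carrier[OF AC BD]
  fix i j assume "i < dim_row ?r" "j < dim_col ?r"
  then have ij: "i < a * a'" "j < c * c'" using kr by auto
  note ij' = div_mod_less_mult[OF ij(1)] div_mod_less_mult[OF ij(2)]
  have "?l $$ (i, j) = (\<Sum>k<b * b'. kronecker A B $$ (i, k) * kronecker C D $$ (k, j))"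
    by (intro mult_mat_index[OF kronecker_carrier[OF A B] kronecker_carrier[OF C D]] ij)
  also have "\<dots> = (\<Sum>k<b * b'. (A $$ (i div a', k div b') * C $$ (k div b', j div c'))
      * (B $$ (i mod a', k mod b') * D $$ (k mod b', j mod c')))"
    using ij by (intro sum.cong) (auto simp: kronecker_index[OF A B] kronecker_index[OF C D])
  also have "\<dots> = (\<Sum>u<b. A $$ (i div a', u) * C $$ (u, j div c'))
      * (\<Sum>v<b'. B $$ (i mod a', v) * D $$ (v, j mod c'))"
    by (subst sum_div_mod) (simp add: sum_product)
  also have "\<dots> = ?r $$ (i, j)"
    using ij ij' by (simp add: kronecker_index[OF AC BD] mult_mat_index[OF A C] mult_mat_index[OF B D])
  finally show "?l $$ (i, j) = ?r $$ (i, j)" .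
qed (use assms in \<open>auto simp: kronecker_def\<close>)

lemma kronecker_transpose: "transpose_mat (kronecker A B) = kronecker (transpose_mat A) (transpose_mat B)"
proof (rule eq_matI)
  fix i j assume "i < dim_row (kronecker A\<^sup>T B\<^sup>T)" "j < dim_col (kronecker A\<^sup>T B\<^sup>T)"
  then have ij: "i < dim_col A * dim_col B" "j < dim_row A * dim_row B"
    by (auto simp: kronecker_def)
  show "(kronecker A B)\<^sup>T $$ (i, j) = kronecker A\<^sup>T B\<^sup>T $$ (i, j)"
    using ij div_mod_less_mult[OF ij(1)] div_mod_less_mult[OF ij(2)] by (auto simp: kronecker_def)
qed (auto simp: kronecker_def)

lemma kronecker_one: "kronecker (1\<^sub>m a) (1\<^sub>m b) = 1\<^sub>m (a * b)"
proof (rule eq_matI)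
  fix i j assume "i < dim_row (1\<^sub>m (a * b) :: real mat)" "j < dim_col (1\<^sub>m (a * b) :: real mat)"
  then have ij: "i < a * b" "j < a * b" by auto
  have "i = j" if "i div b = j div b" "i mod b = j mod b"
    using that by (metis div_mod_decomp)
  then show "kronecker (1\<^sub>m a) (1\<^sub>m b) $$ (i, j) = 1\<^sub>m (a * b) $$ (i, j)"
    using ij div_mod_less_mult[OF ij(1)] div_mod_less_mult[OF ij(2)]
    by (auto simp: kronecker_def)
qed (auto simp: kronecker_def)

lemma lower_tri_groupD:
  assumes "A \<in> lower_tri_group q"
  shows "A \<in> carrier_mat q q" "\<forall>i j. i < j \<longrightarrow> j < q \<longrightarrow> A $$ (i, j) = 0"
    "\<And>i. i < q \<Longrightarrow> 0 < A $$ (i, i)" "Determinant.det A = 1"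
  using assms by (auto simp: lower_tri_group_def)

lemma det_lower_tri:
  fixes A :: "'a::comm_ring_1 mat"
  assumes "A \<in> carrier_mat q q" "\<forall>i j. i < j \<longrightarrow> j < q \<longrightarrow> A $$ (i, j) = 0"
  shows "Determinant.det A = (\<Prod>i<q. A $$ (i, i))"
  using det_lower_triangular[of q A] assms
  by (simp add: prod_list_diag_prod lessThan_atLeast0)

lemma prod_diag_lower_tri:
  "A \<in> lower_tri_group q \<Longrightarrow> (\<Prod>i<q. A $$ (i, i)) = 1"
  using det_lower_tri[of A q] lower_tri_groupD[of A q] by auto

lemma lower_tri_groupI:
  assumes "A \<in> carrier_mat q q" "\<forall>i j. i < j \<longrightarrow> j < q \<longrightarrow> A $$ (i, j) = 0"
    "\<And>i. i < q \<Longrightarrow> 0 < A $$ (i, i)" "(\<Prod>i<q. A $$ (i, i)) = 1"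
  shows "A \<in> lower_tri_group q"
  using assms det_lower_tri[of A q] by (auto simp: lower_tri_group_def)

lemma one_lower_tri_group [simp]: "1\<^sub>m q \<in> lower_tri_group q"
  by (rule lower_tri_groupI) auto

lemma lower_tri_mult_index:
  fixes A B :: "real mat"
  assumes A: "A \<in> carrier_mat q q" "\<forall>i j. i < j \<longrightarrow> j < q \<longrightarrow> A $$ (i, j) = 0"
    and B: "B \<in> carrier_mat q q" "\<forall>i j. i < j \<longrightarrow> j < q \<longrightarrow> B $$ (i, j) = 0"
    and ij: "i < q" "j < q"
  shows "(A * B) $$ (i, j) = (\<Sum>k\<in>{j..i}. A $$ (i, k) * B $$ (k, j))"
proof -
  have "(A * B) $$ (i, j) = (\<Sum>k<q. A $$ (i, k) * B $$ (k, j))"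
    using mult_mat_index[OF A(1) B(1) ij] .
  also have "\<dots> = (\<Sum>k\<in>{j..i}. A $$ (i, k) * B $$ (k, j))"
    using A(2) B(2) ij by (intro sum.mono_neutral_right) (auto simp: not_le)
  finally show ?thesis .
qed

lemma lower_tri_group_mult:
  assumes A: "A \<in> lower_tri_group q" and B: "B \<in> lower_tri_group q"
  shows "A * B \<in> lower_tri_group q"
    and "i < q \<Longrightarrow> (A * B) $$ (i, i) = A $$ (i, i) * B $$ (i, i)"
proof -
  note a = lower_tri_groupD[OF A] and b = lower_tri_groupD[OF B]
  note ix = lower_tri_mult_index[OF a(1,2) b(1,2)]
  show diag: "(A * B) $$ (i, i) = A $$ (i, i) * B $$ (i, i)" if "i < q" for i
    using ix[OF that that] by simp
  show "A * B \<in> lower_tri_group q"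
    unfolding lower_tri_group_def using a b det_mult[OF a(1) b(1)] 
    by (auto simp: ix simp del: index_mult_mat(1))
qed

lemma mat_inv_eq:
  fixes A :: "real mat"
  assumes "A \<in> carrier_mat n n" "Determinant.det A \<noteq> 0"
  shows "mat_inv A \<in> carrier_mat n n" "A * mat_inv A = 1\<^sub>m n" "mat_inv A * A = 1\<^sub>m n"
proof -
  have "A \<in> Units (ring_mat TYPE(real) n ())"
    by (rule det_non_zero_imp_unit[OF assms])
  then obtain B where "mat_inverse A = Some B"
    using mat_inverse(1)[OF assms(1), of "()"] by (cases "mat_inverse A") auto
  with mat_inverse(2)[OF assms(1) this]
  show "mat_inv A \<in> carrier_mat n n" "A * mat_inv A = 1\<^sub>m n" "mat_inv A * A = 1\<^sub>m n"
    by (auto simp: mat_inv_def)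
qed

lemma mat_inv_unique:
  fixes A :: "real mat"
  assumes A: "A \<in> carrier_mat n n" and B: "B \<in> carrier_mat n n" and AB: "A * B = 1\<^sub>m n"
  shows "mat_inv A = B"
proof -
  have "Determinant.det A * Determinant.det B = 1" using det_mult[OF A B] AB by simp
  then have "Determinant.det A \<noteq> 0" by auto
  note inv = mat_inv_eq[OF A this]
  have "mat_inv A = mat_inv A * (A * B)" unfolding AB using inv by simp
  also have "\<dots> = (mat_inv A * A) * B" by (rule assoc_mult_mat[OF inv(1) A B, symmetric])
  also have "\<dots> = B" using inv B by simp
  finally show ?thesis .
qed

lemma lower_tri_group_inv:
  assumes A: "A \<in> lower_tri_group q"
  shows "mat_inv A \<in> lower_tri_group q" "A * mat_inv A = 1\<^sub>m q" "mat_inv A * A = 1\<^sub>m q"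
proof -
  note a = lower_tri_groupD[OF A]
  define B where "B = mat_inv A"
  have B: "B \<in> carrier_mat q q" "A * B = 1\<^sub>m q" "B * A = 1\<^sub>m q"
    unfolding B_def using mat_inv_eq[OF a(1)] a(4) by auto
  have "B $$ (i, j) = 0" if "i < j" "j < q" for i j
    using that
  proof (induction i rule: less_induct)
    case (less i)
    have "0 = (A * B) $$ (i, j)" using less.prems by (simp add: B(2))
    also have "\<dots> = (\<Sum>k<q. A $$ (i, k) * B $$ (k, j))"
      using less.prems by (intro mult_mat_index[OF a(1) B(1)]) auto
    also have "\<dots> = (\<Sum>k\<in>{i}. A $$ (i, k) * B $$ (k, j))"
    proof (intro sum.mono_neutral_right ballI)
      fix k assume "k \<in> {..<q} - {i}"
      then consider "k < i" | "i < k" "k < q" by force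
      then show "A $$ (i, k) * B $$ (k, j) = 0"
        by cases (use less a(2) in auto)
    qed (use less.prems in auto)
    finally show ?case using a(3)[of i] less.prems by auto
  qed
  then have tri: "\<forall>i j. i < j \<longrightarrow> j < q \<longrightarrow> B $$ (i, j) = 0" by blast
  have diag: "A $$ (i, i) * B $$ (i, i) = 1" if "i < q" for i
    using lower_tri_mult_index[OF a(1,2) B(1) tri that that] B(2) that by simp
  have "0 < B $$ (i, i)" if "i < q" for i
    by (rule zero_less_mult_pos[OF _ a(3)[OF that]]) (simp add: diag[OF that])
  moreover have "Determinant.det B = 1" using det_mult[OF a(1) B(1)] a(4) B(2) by simp
  ultimately show "mat_inv A \<in> lower_tri_group q" "A * mat_inv A = 1\<^sub>m q" "mat_inv A * A = 1\<^sub>m q"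
    using B tri by (auto simp: lower_tri_group_def B_def)
qed

lemma kronecker_lower_tri_group:
  assumes A: "A \<in> lower_tri_group a" and B: "B \<in> lower_tri_group b"
  shows "kronecker A B \<in> lower_tri_group (a * b)"
proof (rule lower_tri_groupI)
  note a = lower_tri_groupD[OF A] and b = lower_tri_groupD[OF B]
  note ix = kronecker_index[OF a(1) b(1)]
  show "kronecker A B \<in> carrier_mat (a * b) (a * b)" using a b by simp
  have "kronecker A B $$ (i, j) = 0" if "i < j" "j < a * b" for i j
  proof -
    have i: "i < a * b" using that by simp
    note dm = div_mod_less_mult[OF i] div_mod_less_mult[OF that(2)]
    have "i div b < j div b \<or> i mod b < j mod b"
    proof (rule ccontr)
      assume "\<not> ?thesis"
      moreover have "i div b \<le> j div b" using that by (simp add: div_le_mono)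
      ultimately have "i div b = j div b" "j mod b \<le> i mod b" by auto
      then show False using that by (metis add_le_cancel_left div_mult_mod_eq not_le)
    qed
    then show ?thesis using a(2) b(2) dm that i by (auto simp: ix)
  qed
  then show "\<forall>i j. i < j \<longrightarrow> j < a * b \<longrightarrow> kronecker A B $$ (i, j) = 0" by blast
  show "0 < kronecker A B $$ (i, i)" if "i < a * b" for i
    using a(3) b(3) div_mod_less_mult[OF that] that by (auto simp: ix)
  have "(\<Prod>i<a * b. kronecker A B $$ (i, i))
      = (\<Prod>i<a * b. A $$ (i div b, i div b) * B $$ (i mod b, i mod b))"
    by (intro prod.cong) (auto simp: ix)
  also have "\<dots> = (\<Prod>u<a. \<Prod>v<b. A $$ (u, u) * B $$ (v, v))"
    by (rule prod_div_mod)
  also have "\<dots> = 1"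
    by (simp add: prod.distrib prod_diag_lower_tri[OF A] prod_diag_lower_tri[OF B] prod_power_distrib[symmetric])
  finally show "(\<Prod>i<a * b. kronecker A B $$ (i, i)) = 1" .
qed

abbreviation square_mats :: "real mat list \<Rightarrow> nat list \<Rightarrow> bool" where
  "square_mats \<equiv> list_all2 (\<lambda>A q. A \<in> carrier_mat q q)"

abbreviation lower_mats :: "real mat list \<Rightarrow> nat list \<Rightarrow> bool" where
  "lower_mats \<equiv> list_all2 (\<lambda>A q. A \<in> lower_tri_group q)"

lemma lower_mats_square: "lower_mats As p \<Longrightarrow> square_mats As p"
  by (auto elim!: list_all2_mono dest: lower_tri_groupD)

lemma rev_kronecker_carrier:
  "square_mats As p \<Longrightarrow> rev_kronecker As \<in> carrier_mat (prod_list p) (prod_list p)"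
proof (induction rule: list_all2_induct)
  case (Cons A As q p)
  then show ?case using kronecker_carrier[of "rev_kronecker As" _ _ A q q] by (simp add: mult.commute[of q])
qed simp

lemma rev_kronecker_mult:
  "square_mats As p \<Longrightarrow> square_mats Bs p \<Longrightarrow>
    rev_kronecker (map2 (*) As Bs) = rev_kronecker As * rev_kronecker Bs"
proof (induction arbitrary: Bs rule: list_all2_induct)
  case (Cons A As q p)
  then obtain B Bs' where B: "Bs = B # Bs'" "B \<in> carrier_mat q q" "square_mats Bs' p"
    by (auto simp: list_all2_Cons2)
  show ?case
    using B Cons.IH[OF B(3)] kronecker_mult[OF rev_kronecker_carrier[OF Cons.hyps(2)]
      rev_kronecker_carrier[OF B(3)] Cons.hyps(1) B(2)] by simp
qed simp

lemma rev_kronecker_transpose: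
  "rev_kronecker (map transpose_mat As) = transpose_mat (rev_kronecker As)"
  by (induction As) (auto simp: kronecker_transpose)

lemma rev_kronecker_one: "rev_kronecker (map 1\<^sub>m p) = 1\<^sub>m (prod_list p)"
  by (induction p) (auto simp: kronecker_one mult.commute)

lemma rev_kronecker_lower_tri_group:
  "lower_mats As p \<Longrightarrow> rev_kronecker As \<in> lower_tri_group (prod_list p)"
proof (induction rule: list_all2_induct)
  case (Cons A As q p)
  then show ?case using kronecker_lower_tri_group[of "rev_kronecker As" _ A q] by (simp add: mult.commute[of q])
qed simp

section \<open>The group and the likelihood\<close>

definition haar_density :: "nat list \<Rightarrow> param \<Rightarrow> real" where
  "haar_density p S = 1 / fst S * (\<Prod>k<length p. \<Prod>i\<in>{1..<p ! k}. ((snd S ! k) $$ (i, i)) ^ (i - 1))"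

definition act_mat :: "nat \<Rightarrow> param \<Rightarrow> real mat" where
  "act_mat n S = fst S \<cdot>\<^sub>m rev_kronecker (snd S @ [1\<^sub>m n])"

definition param_one :: "nat list \<Rightarrow> param" where
  "param_one p = (1, map 1\<^sub>m p)"

definition param_inv :: "param \<Rightarrow> param" where
  "param_inv S = (inverse (fst S), map mat_inv (snd S))"

definition likelihood :: "nat list \<Rightarrow> nat \<Rightarrow> param \<Rightarrow> array \<Rightarrow> real" where
  "likelihood p n S X = inverse (fst S) ^ prod_list (p @ [n])
     * exp (- scalar_prod (mat_inv (act_mat n S) *\<^sub>v array_vec (p @ [n]) X)
                          (mat_inv (act_mat n S) *\<^sub>v array_vec (p @ [n]) X) / 2)"

lemma param_groupD:
  assumes "S \<in> param_group p"
  shows "0 < fst S" "lower_mats (snd S) p"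
  using assms by (auto simp: param_group_def)

lemma param_group_iff: "S \<in> param_group p \<longleftrightarrow> 0 < fst S \<and> lower_mats (snd S) p"
  by (cases S) (auto simp: param_group_def)

lemma param_group_nth:
  assumes "S \<in> param_group p" "k < length p"
  shows "snd S ! k \<in> lower_tri_group (p ! k)"
  using param_groupD(2)[OF assms(1)] assms(2) by (auto simp: list_all2_conv_all_nth)

lemma param_group_length: "S \<in> param_group p \<Longrightarrow> length (snd S) = length p"
  by (auto simp: param_group_iff dest: list_all2_lengthD)

lemma param_mult_nth:
  assumes "S \<in> param_group p" "T \<in> param_group p" "k < length p"
  shows "snd (param_mult S T) ! k = snd S ! k * snd T ! k"
  using assms by (auto simp: param_mult_def param_group_length)

lemma param_mult_in [simp]:
  assumes "S \<in> param_group p" "T \<in> param_group p"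
  shows "param_mult S T \<in> param_group p"
  unfolding param_group_iff list_all2_conv_all_nth
proof (intro conjI allI impI)
  show "0 < fst (param_mult S T)"
    using param_groupD(1)[OF assms(1)] param_groupD(1)[OF assms(2)] by (simp add: param_mult_def)
  show len: "length (snd (param_mult S T)) = length p"
    using assms by (simp add: param_mult_def param_group_length)
  fix k assume "k < length (snd (param_mult S T))"
  then have k: "k < length p" using len by simp
  show "snd (param_mult S T) ! k \<in> lower_tri_group (p ! k)"
    unfolding param_mult_nth[OF assms k]
    by (intro lower_tri_group_mult param_group_nth assms k)
qed

lemma param_one_in [simp]: "param_one p \<in> param_group p"
  by (auto simp: param_group_iff param_one_def list_all2_conv_all_nth)

lemma param_inv_in [simp]: "S \<in> param_group p \<Longrightarrow> param_inv S \<in> param_group p"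
  by (auto simp: param_group_iff param_inv_def list_all2_conv_all_nth lower_tri_group_inv)

lemma param_mult_one [simp]: 
  assumes "S \<in> param_group p"
  shows "param_mult S (param_one p) = S"
proof (rule prod_eqI)
  show "snd (param_mult S (param_one p)) = snd S"
  proof (rule nth_equalityI)
    fix k assume "k < length (snd (param_mult S (param_one p)))"
    then have k: "k < length p"
      using assms param_group_length[of "param_mult S (param_one p)" p] by simp
    show "snd (param_mult S (param_one p)) ! k = snd S ! k"
      using k lower_tri_groupD(1)[OF param_group_nth[OF assms k]]
      unfolding param_mult_nth[OF assms param_one_in k] by (simp add: param_one_def)
  qed (use assms in \<open>simp add: param_group_length[of _ p]\<close>)
qed (simp add: param_mult_def param_one_def)

lemma param_mult_inv_cancel:
  assumes A: "A \<in> param_group p" and B: "B \<in> param_group p"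
  shows "param_mult A (param_mult (param_inv A) B) = B"
proof (rule prod_eqI)
  show "fst (param_mult A (param_mult (param_inv A) B)) = fst B"
    using param_groupD(1)[OF A] by (simp add: param_mult_def param_inv_def)
  show "snd (param_mult A (param_mult (param_inv A) B)) = snd B"
  proof (rule nth_equalityI)
    fix k assume "k < length (snd (param_mult A (param_mult (param_inv A) B)))"
    then have k: "k < length p"
      using A B param_group_length[of "param_mult A (param_mult (param_inv A) B)" p] by simp
    note Ak = param_group_nth[OF A k] and Bk = param_group_nth[OF B k]
    note inv = lower_tri_group_inv[OF Ak]
    have "snd (param_inv A) ! k = mat_inv (snd A ! k)"
      using k A by (simp add: param_inv_def param_group_length)
    then have "snd (param_mult A (param_mult (param_inv A) B)) ! k
        = snd A ! k * (mat_inv (snd A ! k) * snd B ! k)"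
      using A B k by (simp add: param_mult_nth[where p = p])
    also have "\<dots> = (snd A ! k * mat_inv (snd A ! k)) * snd B ! k"
      by (rule assoc_mult_mat[OF lower_tri_groupD(1)[OF Ak] lower_tri_groupD(1)[OF inv(1)]
            lower_tri_groupD(1)[OF Bk], symmetric])
    also have "\<dots> = snd B ! k" unfolding inv using lower_tri_groupD(1)[OF Bk] by simp
    finally show "snd (param_mult A (param_mult (param_inv A) B)) ! k = snd B ! k" .
  qed (use A B param_group_length[of _ p] in simp)
qed

lemma square_mats_dims:
  assumes "square_mats As q"
  shows "map dim_row As = q" "map dim_col As = q"
  using assms by (induction rule: list_all2_induct) auto

context
  fixes p :: "nat list" and n :: nat and N :: nat
  defines "N \<equiv> prod_list (p @ [n])"
begin

lemma lower_mats_snoc: "S \<in> param_group p \<Longrightarrow> lower_mats (snd S @ [1\<^sub>m n]) (p @ [n])"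
  by (intro list_all2_appendI) (auto dest: param_groupD)

lemma rev_kronecker_snoc:
  "S \<in> param_group p \<Longrightarrow> rev_kronecker (snd S @ [1\<^sub>m n]) \<in> lower_tri_group N"
  unfolding N_def by (intro rev_kronecker_lower_tri_group lower_mats_snoc)

lemma act_mat_carrier [simp]: "S \<in> param_group p \<Longrightarrow> act_mat n S \<in> carrier_mat N N"
  using rev_kronecker_snoc[THEN lower_tri_groupD(1)] by (simp add: act_mat_def)

lemma det_act_mat: "S \<in> param_group p \<Longrightarrow> Determinant.det (act_mat n S) = fst S ^ N"
  using lower_tri_groupD(1,4)[OF rev_kronecker_snoc[of S]] by (auto simp: act_mat_def)

lemma act_mat_lower:
  "S \<in> param_group p \<Longrightarrow> i < j \<Longrightarrow> j < N \<Longrightarrow> act_mat n S $$ (i, j) = 0"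
  using lower_tri_groupD(1,2)[OF rev_kronecker_snoc[of S]] by (auto simp: act_mat_def)

lemma act_mat_diag_pos:
  "S \<in> param_group p \<Longrightarrow> i < N \<Longrightarrow> 0 < act_mat n S $$ (i, i)"
  using lower_tri_groupD(1,3)[OF rev_kronecker_snoc[of S]] param_groupD(1)[of S p]
  by (auto simp: act_mat_def)

lemma act_mat_inv:
  assumes "S \<in> param_group p"
  shows "mat_inv (act_mat n S) \<in> carrier_mat N N" "act_mat n S * mat_inv (act_mat n S) = 1\<^sub>m N"
    "mat_inv (act_mat n S) * act_mat n S = 1\<^sub>m N"
  using mat_inv_eq[OF act_mat_carrier[OF assms]] det_act_mat[OF assms] param_groupD(1)[OF assms]
  by auto

lemma smult_mult_smult:
  fixes A B :: "real mat"
  assumes "A \<in> carrier_mat k l" "B \<in> carrier_mat l m"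
  shows "(a \<cdot>\<^sub>m A) * (b \<cdot>\<^sub>m B) = (a * b) \<cdot>\<^sub>m (A * B)"
  using assms by (intro eq_matI) (auto simp: scalar_prod_def sum_distrib_left ac_simps intro!: sum.cong)

lemma one_smult_mat [simp]: "(1::real) \<cdot>\<^sub>m A = A"
  by (intro eq_matI) auto

lemma smult_mat_mult_vec:
  fixes A :: "real mat"
  assumes "A \<in> carrier_mat k l" "x \<in> carrier_vec l"
  shows "(c \<cdot>\<^sub>m A) *\<^sub>v x = c \<cdot>\<^sub>v (A *\<^sub>v x)"
  using assms by (intro eq_vecI) auto

lemma act_mat_mult:
  assumes S: "S \<in> param_group p" and T: "T \<in> param_group p"
  shows "act_mat n (param_mult S T) = act_mat n S * act_mat n T"
proof -
  have "snd (param_mult S T) @ [1\<^sub>m n] = map2 (*) (snd S @ [1\<^sub>m n]) (snd T @ [1\<^sub>m n])"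
    using S T by (simp add: param_mult_def param_group_length)
  then have "rev_kronecker (snd (param_mult S T) @ [1\<^sub>m n])
      = rev_kronecker (snd S @ [1\<^sub>m n]) * rev_kronecker (snd T @ [1\<^sub>m n])"
    using rev_kronecker_mult[of "snd S @ [1\<^sub>m n]" "p @ [n]" "snd T @ [1\<^sub>m n]"]
      S T lower_mats_snoc lower_mats_square by auto
  then show ?thesis
    using smult_mult_smult[OF lower_tri_groupD(1)[OF rev_kronecker_snoc[OF S]] lower_tri_groupD(1)[OF rev_kronecker_snoc[OF T]]]
    by (simp add: act_mat_def) (simp add: param_mult_def)
qed

lemma dims_snoc:
  assumes "S \<in> param_group p"
  shows "map dim_row (snd S @ [1\<^sub>m n]) = p @ [n]" "map dim_col (snd S @ [1\<^sub>m n]) = p @ [n]"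
  using square_mats_dims[OF lower_mats_square[OF lower_mats_snoc[OF assms]]] by simp_all

lemma array_act_eq:
  assumes S: "S \<in> param_group p"
  shows "array_act p n S X = array_of_vec (p @ [n]) (act_mat n S *\<^sub>v array_vec (p @ [n]) X)"
proof -
  let ?R = "rev_kronecker (snd S @ [1\<^sub>m n])"
  have R: "?R \<in> carrier_mat N N" using lower_tri_groupD(1)[OF rev_kronecker_snoc[OF S]] .
  have "array_vec (p @ [n]) (array_scale (p @ [n]) (fst S) X) = fst S \<cdot>\<^sub>v array_vec (p @ [n]) X"
    by (intro eq_vecI) (auto simp: array_vec_def array_scale_def multi_index_in)
  moreover have "?R *\<^sub>v (fst S \<cdot>\<^sub>v array_vec (p @ [n]) X) = act_mat n S *\<^sub>v array_vec (p @ [n]) X"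
    using R by (intro eq_vecI)
      (auto simp: act_mat_def scalar_prod_def N_def array_vec_def sum_distrib_left ac_simps intro!: sum.cong)
  ultimately show ?thesis
    unfolding array_act_def tucker_def dims_snoc[OF S] by simp
qed

lemma array_vec_act:
  "S \<in> param_group p \<Longrightarrow>
    array_vec (p @ [n]) (array_act p n S X) = act_mat n S *\<^sub>v array_vec (p @ [n]) X"
  unfolding array_act_eq
  by (intro array_vec_of_vec mult_mat_vec_carrier[OF act_mat_carrier[unfolded N_def]] array_vec_carrier)

lemma array_act_apply:
  assumes "S \<in> param_group p" "is \<in> array_index (p @ [n])"
  shows "array_act p n S X is
    = (\<Sum>t\<le>vec_pos (p @ [n]) is. act_mat n S $$ (vec_pos (p @ [n]) is, t) * X (multi_index (p @ [n]) t))"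
proof -
  let ?s = "vec_pos (p @ [n]) is"
  have s: "?s < N" using vec_pos_less[OF assms(2)] by (simp add: N_def)
  have "array_act p n S X is = (\<Sum>t<N. act_mat n S $$ (?s, t) * X (multi_index (p @ [n]) t))"
    using s act_mat_carrier[OF assms(1)] assms(2)
    by (auto simp: array_act_eq[OF assms(1)] array_of_vec_def scalar_prod_def array_vec_def
        lessThan_atLeast0 N_def intro!: sum.cong)
  also have "\<dots> = (\<Sum>t\<le>?s. act_mat n S $$ (?s, t) * X (multi_index (p @ [n]) t))"
    using s act_mat_lower[OF assms(1)] by (intro sum.mono_neutral_right) auto
  finally show ?thesis .
qed

lemma model_cov_eq:
  assumes S: "S \<in> param_group p"
  shows "model_cov n S = act_mat n S * transpose_mat (act_mat n S)"
proof -
  let ?P = "snd S @ [1\<^sub>m n]"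
  have R: "rev_kronecker ?P \<in> carrier_mat N N"
    using lower_tri_groupD(1)[OF rev_kronecker_snoc[OF S]] .
  have sq: "square_mats ?P (p @ [n])" by (intro lower_mats_square lower_mats_snoc S)
  then have sq': "square_mats (map transpose_mat ?P) (p @ [n])"
    by (simp only: list_all2_map1 transpose_carrier_mat)
  have "map (\<lambda>\<Psi>. \<Psi> * \<Psi>\<^sup>T) (snd S) @ [1\<^sub>m n] = map2 (*) ?P (map transpose_mat ?P)"
    by (simp add: map2_map_map[symmetric] zip_map2 zip_same_conv_map)
  then have "rev_kronecker (map (\<lambda>\<Psi>. \<Psi> * \<Psi>\<^sup>T) (snd S) @ [1\<^sub>m n])
      = rev_kronecker ?P * transpose_mat (rev_kronecker ?P)"
    using rev_kronecker_mult[OF sq sq'] by (simp only: rev_kronecker_transpose)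
  moreover have "transpose_mat (act_mat n S) = fst S \<cdot>\<^sub>m transpose_mat (rev_kronecker ?P)"
    by (intro eq_matI) (auto simp: act_mat_def)
  ultimately show ?thesis
    using smult_mult_smult[OF R transpose_carrier_mat[THEN iffD2, OF R]] 
    by (simp add: model_cov_def act_mat_def power2_eq_square)
qed

lemma mvn_density_model:
  assumes S: "S \<in> param_group p"
  shows "mvn_density (model_cov n S) (array_vec (p @ [n]) X)
    = likelihood p n S X / sqrt ((2 * pi) ^ N)"
proof -
  let ?M = "act_mat n S" and ?I = "mat_inv (act_mat n S)" and ?x = "array_vec (p @ [n]) X"
  note M = act_mat_carrier[OF S] and I = act_mat_inv[OF S]
  have x: "?x \<in> carrier_vec N" unfolding N_def by (rule array_vec_carrier)
  have s: "0 < fst S" using param_groupD(1)[OF S] .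
  have IT: "?I\<^sup>T \<in> carrier_mat N N" and MT: "?M\<^sup>T \<in> carrier_mat N N" using I(1) M by auto
  have "(?M * ?M\<^sup>T) * (?I\<^sup>T * ?I) = ?M * (?M\<^sup>T * (?I\<^sup>T * ?I))"
    using M MT IT I(1) by (intro assoc_mult_mat[of _ N N _ N _ N]) auto
  also have "?M\<^sup>T * (?I\<^sup>T * ?I) = (?M\<^sup>T * ?I\<^sup>T) * ?I"
    using M MT IT I(1) by (intro assoc_mult_mat[of _ N N _ N _ N, symmetric]) auto
  also have "?M\<^sup>T * ?I\<^sup>T = (?I * ?M)\<^sup>T" using transpose_mult[OF I(1) M] by simp
  finally have "(?M * ?M\<^sup>T) * (?I\<^sup>T * ?I) = 1\<^sub>m N" using I by simp
  then have inv: "mat_inv (?M * ?M\<^sup>T) = ?I\<^sup>T * ?I"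
    using M MT IT I(1) by (intro mat_inv_unique[of _ N]) auto
  have "scalar_prod ?x (mat_inv (model_cov n S) *\<^sub>v ?x) = scalar_prod ?x (?I\<^sup>T *\<^sub>v (?I *\<^sub>v ?x))"
    using assoc_mult_mat_vec[OF IT I(1) x] by (simp add: inv model_cov_eq[OF S])
  also have "\<dots> = scalar_prod (?I *\<^sub>v ?x) (?I *\<^sub>v ?x)"
    using transpose_vec_mult_scalar[OF I(1) x, of "?I *\<^sub>v ?x"] I(1) x
    by (metis mult_mat_vec_carrier comm_scalar_prod IT)
  finally have q: "scalar_prod ?x (mat_inv (model_cov n S) *\<^sub>v ?x)
    = scalar_prod (?I *\<^sub>v ?x) (?I *\<^sub>v ?x)" .
  have "Determinant.det (model_cov n S) = (fst S ^ N)\<^sup>2"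
    using det_mult[OF M MT] det_transpose[OF M] det_act_mat[OF S]
    by (simp add: model_cov_eq[OF S] power2_eq_square)
  moreover have "dim_row (model_cov n S) = N" using M by (simp add: model_cov_eq[OF S])
  ultimately have "sqrt ((2 * pi) ^ dim_row (model_cov n S) * Determinant.det (model_cov n S))
      = sqrt ((2 * pi) ^ N) * fst S ^ N"
    using s by (simp only: real_sqrt_mult) simp
  then show ?thesis
    unfolding mvn_density_def q likelihood_def N_def[symmetric]
    by (simp only: power_inverse divide_inverse inverse_mult_distrib mult_ac minus_mult_left)
qed

lemma posterior_kernel_eq:
  assumes S: "S \<in> param_group p"
  shows "posterior_kernel p n X S = likelihood p n S X * haar_density p S"
proof -
  let ?x = "array_vec (p @ [n]) X" and ?i = "map mat_inv (snd S) @ [1\<^sub>m n]"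
  have x: "?x \<in> carrier_vec N" unfolding N_def by (rule array_vec_carrier)
  have T: "param_inv S \<in> param_group p" using S by simp
  have i: "?i = snd (param_inv S) @ [1\<^sub>m n]" by (simp add: param_inv_def)
  have "param_mult S (param_inv S) = param_one p"
    using param_mult_inv_cancel[OF S param_one_in] T by simp
  then have "act_mat n S * act_mat n (param_inv S) = act_mat n (param_one p)"
    using act_mat_mult[OF S T] by simp
  also have "\<dots> = 1\<^sub>m N"
    unfolding act_mat_def param_one_def N_def rev_kronecker_one[symmetric]
    by (simp del: prod_list.append)
  finally have inv: "mat_inv (act_mat n S) = act_mat n (param_inv S)"
    by (intro mat_inv_unique[of _ N] act_mat_carrier S T)
  have Ri: "rev_kronecker ?i \<in> carrier_mat N N"
    unfolding i using lower_tri_groupD(1)[OF rev_kronecker_snoc[OF T]] .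
  define v where "v = rev_kronecker ?i *\<^sub>v ?x"
  have v: "v \<in> carrier_vec (prod_list (p @ [n]))"
    unfolding v_def N_def[symmetric] by (rule mult_mat_vec_carrier[OF Ri x])
  have "tucker X ?i = array_of_vec (p @ [n]) v"
    unfolding tucker_def v_def i dims_snoc[OF T] ..
  then have frob: "(frob_norm (p @ [n]) (tucker X ?i))\<^sup>2 = scalar_prod v v"
    unfolding frob_norm_sq using array_vec_of_vec[OF v] by metis
  have "mat_inv (act_mat n S) *\<^sub>v ?x = inverse (fst S) \<cdot>\<^sub>v v"
    unfolding inv unfolding act_mat_def i[symmetric] smult_mat_mult_vec[OF Ri x] v_def
    by (simp add: param_inv_def)
  then have q: "scalar_prod (mat_inv (act_mat n S) *\<^sub>v ?x) (mat_inv (act_mat n S) *\<^sub>v ?x)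
      = inverse (fst S) * (inverse (fst S) * (frob_norm (p @ [n]) (tucker X ?i))\<^sup>2)"
    unfolding frob by simp
  have "likelihood p n S X = inverse (fst S) ^ (n * prod_list p)
      * exp (- (1 / (2 * (fst S)\<^sup>2)) * (frob_norm (p @ [n]) (tucker X ?i))\<^sup>2)"
    unfolding likelihood_def q prod_list.append
    by (simp only: divide_inverse power2_eq_square inverse_mult_distrib mult_minus_left mult_minus_right mult_1_left
        prod_list.Cons prod_list.Nil mult_1_right mult_ac)
  then show ?thesis
    unfolding posterior_kernel_def haar_density_def case_prod_beta by (simp only: mult.assoc)
qed

lemma likelihood_act:
  assumes A: "A \<in> param_group p" and S: "S \<in> param_group p"
  shows "likelihood p n (param_mult A S) (array_act p n A X)
    = inverse (fst A) ^ N * likelihood p n S X"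
proof -
  let ?A = "act_mat n A" and ?S = "act_mat n S" and ?x = "array_vec (p @ [n]) X"
  note a = act_mat_carrier[OF A] act_mat_inv[OF A] and s = act_mat_carrier[OF S] act_mat_inv[OF S]
  have x: "?x \<in> carrier_vec N" unfolding N_def by (rule array_vec_carrier)
  have "(?A * ?S) * (mat_inv ?S * mat_inv ?A) = ?A * (?S * (mat_inv ?S * mat_inv ?A))"
    using a(1,2) s(1,2) by (intro assoc_mult_mat[of _ N N _ N _ N]) auto
  also have "?S * (mat_inv ?S * mat_inv ?A) = (?S * mat_inv ?S) * mat_inv ?A"
    using a(1,2) s(1,2) by (intro assoc_mult_mat[of _ N N _ N _ N, symmetric]) auto
  finally have "(?A * ?S) * (mat_inv ?S * mat_inv ?A) = 1\<^sub>m N" using a s by simp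
  then have "mat_inv (?A * ?S) = mat_inv ?S * mat_inv ?A"
    using a(1,2) s(1,2) by (intro mat_inv_unique[of _ N]) auto
  then have "mat_inv (?A * ?S) *\<^sub>v (?A *\<^sub>v ?x) = mat_inv ?S *\<^sub>v (mat_inv ?A *\<^sub>v (?A *\<^sub>v ?x))"
    using a(1,2) s(1,2) x by simp
  also have "mat_inv ?A *\<^sub>v (?A *\<^sub>v ?x) = ?x"
    using a x by (simp add: assoc_mult_mat_vec[symmetric])
  finally have "mat_inv (act_mat n (param_mult A S)) *\<^sub>v (?A *\<^sub>v ?x) = mat_inv ?S *\<^sub>v ?x"
    by (simp add: act_mat_mult[OF A S])
  then show ?thesis
    unfolding likelihood_def array_vec_act[OF A]
    by (simp add: param_mult_def power_mult_distrib N_def)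
qed

end

lemma haar_density_pos: "S \<in> param_group p \<Longrightarrow> 0 < haar_density p S"
  unfolding haar_density_def
  using param_groupD(1)[of S p] lower_tri_groupD(3)[OF param_group_nth[of S p]]
  by (auto intro!: mult_pos_pos prod_pos divide_pos_pos zero_less_power)

lemma haar_density_mult:
  assumes "S \<in> param_group p" "T \<in> param_group p"
  shows "haar_density p (param_mult S T) = haar_density p S * haar_density p T"
proof -
  have "(\<Prod>k<length p. \<Prod>i\<in>{1..<p ! k}. ((snd (param_mult S T) ! k) $$ (i, i)) ^ (i - 1))
    = (\<Prod>k<length p. \<Prod>i\<in>{1..<p ! k}. ((snd S ! k) $$ (i, i)) ^ (i - 1) * ((snd T ! k) $$ (i, i)) ^ (i - 1))"
    using assms by (intro prod.cong refl)
      (simp add: param_mult_nth[where p = p] lower_tri_group_mult(2)[OF param_group_nth param_group_nth] power_mult_distrib del: index_mult_mat(1))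
  then show ?thesis
    by (simp add: haar_density_def prod.distrib) (simp add: param_mult_def)
qed

lemma likelihood_pos: "S \<in> param_group p \<Longrightarrow> 0 < likelihood p n S X"
  using param_groupD(1)[of S p] by (simp add: likelihood_def)

section \<open>Measurability\<close>

definition measurable_mat :: "'w measure \<Rightarrow> nat \<Rightarrow> nat \<Rightarrow> ('w \<Rightarrow> real mat) \<Rightarrow> bool" where
  "measurable_mat M r c F \<longleftrightarrow> (\<forall>w\<in>space M. F w \<in> carrier_mat r c)
     \<and> (\<forall>i<r. \<forall>j<c. (\<lambda>w. F w $$ (i, j)) \<in> borel_measurable M)"

lemma measurable_matD:
  assumes "measurable_mat M r c F"
  shows "w \<in> space M \<Longrightarrow> F w \<in> carrier_mat r c"
    "i < r \<Longrightarrow> j < c \<Longrightarrow> (\<lambda>w. F w $$ (i, j)) \<in> borel_measurable M"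
  using assms by (auto simp: measurable_mat_def)

lemma measurable_matI:
  assumes "\<And>w. w \<in> space M \<Longrightarrow> F w \<in> carrier_mat r c"
    and "\<And>i j w. i < r \<Longrightarrow> j < c \<Longrightarrow> w \<in> space M \<Longrightarrow> F w $$ (i, j) = f i j w"
    and "\<And>i j. i < r \<Longrightarrow> j < c \<Longrightarrow> f i j \<in> borel_measurable M"
  shows "measurable_mat M r c F"
  unfolding measurable_mat_def
proof (intro conjI ballI allI impI)
  fix i j assume "i < r" "j < c"
  then show "(\<lambda>w. F w $$ (i, j)) \<in> borel_measurable M"
    using assms(3)[of i j] assms(2)[of i j] by (subst measurable_cong[of M _ "f i j"]) auto
qed (use assms in auto)

lemma measurable_mat_const: "A \<in> carrier_mat r c \<Longrightarrow> measurable_mat M r c (\<lambda>_. A)"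
  by (auto simp: measurable_mat_def)

lemma measurable_mat_smult:
  assumes "f \<in> borel_measurable M" "measurable_mat M r c F"
  shows "measurable_mat M r c (\<lambda>w. f w \<cdot>\<^sub>m F w)"
proof (rule measurable_matI[where f = "\<lambda>i j w. f w * F w $$ (i, j)"])
  fix w assume "w \<in> space M"
  from measurable_matD(1)[OF assms(2) this]
  show "f w \<cdot>\<^sub>m F w \<in> carrier_mat r c"
    "\<And>i j. i < r \<Longrightarrow> j < c \<Longrightarrow> (f w \<cdot>\<^sub>m F w) $$ (i, j) = f w * F w $$ (i, j)" by auto
qed (intro borel_measurable_times assms(1) measurable_matD(2)[OF assms(2)])

lemma measurable_mat_cong:
  assumes "\<And>w. w \<in> space M \<Longrightarrow> F w = G w"
  shows "measurable_mat M r c F \<longleftrightarrow> measurable_mat M r c G"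
  using assms by (auto simp: measurable_mat_def cong: measurable_cong)

lemma measurable_mat_mult:
  assumes "measurable_mat M a b F" "measurable_mat M b c G"
  shows "measurable_mat M a c (\<lambda>w. F w * G w)"
  by (rule measurable_matI[where f = "\<lambda>i j w. \<Sum>k<b. F w $$ (i, k) * G w $$ (k, j)"])
    (use measurable_matD[OF assms(1)] measurable_matD[OF assms(2)] in
      \<open>auto intro!: borel_measurable_sum borel_measurable_times mult_mat_index mult_carrier_mat
        simp del: index_mult_mat(1)\<close>)

lemma measurable_mat_kronecker:
  assumes "measurable_mat M a b F" "measurable_mat M c d G"
  shows "measurable_mat M (a * c) (b * d) (\<lambda>w. kronecker (F w) (G w))"
proof (rule measurable_matI[where f = "\<lambda>i j w. F w $$ (i div c, j div d) * G w $$ (i mod c, j mod d)"])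
  show "kronecker (F w) (G w) \<in> carrier_mat (a * c) (b * d)" if "w \<in> space M" for w
    using that measurable_matD(1)[OF assms(1)] measurable_matD(1)[OF assms(2)] by simp
  fix i j assume ij: "i < a * c" "j < b * d"
  show "kronecker (F w) (G w) $$ (i, j) = F w $$ (i div c, j div d) * G w $$ (i mod c, j mod d)"
    if "w \<in> space M" for w
    using measurable_matD(1)[OF assms(1) that] measurable_matD(1)[OF assms(2) that] ij
    by (rule kronecker_index)
  show "(\<lambda>w. F w $$ (i div c, j div d) * G w $$ (i mod c, j mod d)) \<in> borel_measurable M"
    using ij by (intro borel_measurable_times measurable_matD(2)[OF assms(1)]
      measurable_matD(2)[OF assms(2)] div_mod_less_mult)
qed

lemma measurable_det:
  assumes "measurable_mat M n n F"
  shows "(\<lambda>w. Determinant.det (F w)) \<in> borel_measurable M"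
proof -
  have "(\<lambda>w. \<Sum>\<pi> | \<pi> permutes {0..<n}. signof \<pi> * (\<Prod>i = 0..<n. F w $$ (i, \<pi> i))) \<in> borel_measurable M"
    by (intro borel_measurable_sum borel_measurable_times borel_measurable_prod measurable_matD(2)[OF assms])
      (auto simp: permutes_in_image)
  then show ?thesis
    using measurable_matD(1)[OF assms] by (subst measurable_cong[OF det_def']) auto
qed

lemma measurable_mat_inv:
  assumes F: "measurable_mat M n n F" and det: "\<And>w. w \<in> space M \<Longrightarrow> Determinant.det (F w) \<noteq> 0"
  shows "measurable_mat M n n (\<lambda>w. mat_inv (F w))"
proof (rule measurable_matI[where f = "\<lambda>i j w. inverse (Determinant.det (F w)) * cofactor (F w) j i"])
  note carrier = measurable_matD(1)[OF F]
  show "mat_inv (F w) \<in> carrier_mat n n" if "w \<in> space M" for w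
    using mat_inv_eq(1)[OF carrier det] that by simp
  fix i j assume ij: "i < n" "j < n"
  show "mat_inv (F w) $$ (i, j) = inverse (Determinant.det (F w)) * cofactor (F w) j i"
    if w: "w \<in> space M" for w
  proof -
    note A = carrier[OF w] note adj = adj_mat[OF A]
    have "F w * (inverse (Determinant.det (F w)) \<cdot>\<^sub>m adj_mat (F w)) = 1\<^sub>m n"
      unfolding mult_smult_distrib[OF A adj(1)] adj(2) using det[OF w]
      by (intro eq_matI) auto
    then have "mat_inv (F w) = inverse (Determinant.det (F w)) \<cdot>\<^sub>m adj_mat (F w)"
      using A adj(1) by (intro mat_inv_unique[of _ n]) auto
    then show ?thesis using A ij by (simp add: adj_mat_def)
  qed
  have "measurable_mat M (n - 1) (n - 1) (\<lambda>w. mat_delete (F w) j i)"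
  proof (rule measurable_matI[where f = "\<lambda>i' j' w. F w $$ (if i' < j then i' else Suc i', if j' < i then j' else Suc j')"])
    show "mat_delete (F w) j i \<in> carrier_mat (n - 1) (n - 1)" if "w \<in> space M" for w
      using mat_delete_carrier[OF carrier[OF that]] .
    fix i' j' assume ij': "i' < n - 1" "j' < n - 1"
    show "mat_delete (F w) j i $$ (i', j')
        = F w $$ (if i' < j then i' else Suc i', if j' < i then j' else Suc j')" if "w \<in> space M" for w
      using ij' carrier[OF that] by (auto simp: mat_delete_def)
    show "(\<lambda>w. F w $$ (if i' < j then i' else Suc i', if j' < i then j' else Suc j')) \<in> borel_measurable M"
      using ij' by (intro measurable_matD(2)[OF F]) auto
  qed
  from measurable_det[OF this]
  show "(\<lambda>w. inverse (Determinant.det (F w)) * cofactor (F w) j i) \<in> borel_measurable M"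
    unfolding cofactor_def using measurable_det[OF F] by measurable
qed

lemma measurable_mat_rev_kronecker:
  assumes "list_all2 (\<lambda>G q. measurable_mat M q q G) Gs d"
  shows "measurable_mat M (prod_list d) (prod_list d) (\<lambda>w. rev_kronecker (map (\<lambda>G. G w) Gs))"
  using assms
proof (induction rule: list_all2_induct)
  case Nil
  show ?case by (simp add: measurable_mat_const)
next
  case (Cons G Gs q d)
  then show ?case
    using measurable_mat_kronecker[OF Cons.IH Cons.hyps(1)] by (simp add: mult.commute[of q])
qed

lemma space_param_borel [simp]: "space (param_borel p) = param_group p"
  by (simp add: param_borel_def)

lemma measurable_param_entries: 
  "param_entries p \<in> param_borel p \<rightarrow>\<^sub>M borel \<Otimes>\<^sub>M PiM (entry_index p) (\<lambda>_. borel)"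
  unfolding param_borel_def
  by (rule measurable_vimage_algebra1) (auto simp: param_entries_def space_pair_measure space_PiM)

lemma measurable_param_fst [measurable]: "fst \<in> borel_measurable (param_borel p)"
  using measurable_compose[OF measurable_param_entries measurable_fst]
  by (simp add: param_entries_def)

lemma measurable_param_entry:
  assumes "k < length p" "i < p ! k" "j < p ! k"
  shows "(\<lambda>S. (snd S ! k) $$ (i, j)) \<in> borel_measurable (param_borel p)"
proof -
  have "(k, i, j) \<in> entry_index p" using assms by (simp add: entry_index_def)
  from measurable_compose[OF measurable_compose[OF measurable_param_entries measurable_snd]
      measurable_component_singleton[OF this]] this
  show ?thesis by (simp add: param_entries_def)
qed

lemma measurable_param_mat:
  assumes "F \<in> M \<rightarrow>\<^sub>M param_borel p" "k < length p"
  shows "measurable_mat M (p ! k) (p ! k) (\<lambda>w. snd (F w) ! k)"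
  unfolding measurable_mat_def
proof (intro conjI ballI allI impI)
  show "snd (F w) ! k \<in> carrier_mat (p ! k) (p ! k)" if "w \<in> space M" for w
    using measurable_space[OF assms(1) that] param_group_nth[OF _ assms(2)] lower_tri_groupD(1) by auto
  show "(\<lambda>w. (snd (F w) ! k) $$ (i, j)) \<in> borel_measurable M" if "i < p ! k" "j < p ! k" for i j
    using measurable_compose[OF assms(1) measurable_param_entry[OF assms(2) that]] .
qed

lemma measurable_param_borelI:
  assumes "\<And>w. w \<in> space M \<Longrightarrow> F w \<in> param_group p"
    and "(\<lambda>w. fst (F w)) \<in> borel_measurable M"
    and "\<And>k. k < length p \<Longrightarrow> measurable_mat M (p ! k) (p ! k) (\<lambda>w. snd (F w) ! k)"
  shows "F \<in> M \<rightarrow>\<^sub>M param_borel p"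
  unfolding param_borel_def
proof (rule measurable_vimage_algebra2)
  show "(\<lambda>w. param_entries p (F w)) \<in> M \<rightarrow>\<^sub>M borel \<Otimes>\<^sub>M PiM (entry_index p) (\<lambda>_. borel)"
    unfolding param_entries_def
  proof (intro measurable_Pair assms(2) measurable_restrict)
    fix t assume "t \<in> entry_index p"
    then show "(\<lambda>w. case t of (k, i, j) \<Rightarrow> (snd (F w) ! k) $$ (i, j)) \<in> borel_measurable M"
      using measurable_matD(2)[OF assms(3)] by (auto simp: entry_index_def)
  qed
qed (use assms in auto)

lemma measurable_param_mult [measurable]:
  assumes F: "F \<in> M \<rightarrow>\<^sub>M param_borel p" and G: "G \<in> M \<rightarrow>\<^sub>M param_borel p"
  shows "(\<lambda>w. param_mult (F w) (G w)) \<in> M \<rightarrow>\<^sub>M param_borel p"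
proof (rule measurable_param_borelI)
  have in_group: "F w \<in> param_group p" "G w \<in> param_group p" if "w \<in> space M" for w
    using measurable_space[OF F that] measurable_space[OF G that] by auto
  show "param_mult (F w) (G w) \<in> param_group p" if "w \<in> space M" for w
    using in_group[OF that] by simp
  show "(\<lambda>w. fst (param_mult (F w) (G w))) \<in> borel_measurable M"
    using F G by (simp add: param_mult_def)
  fix k assume k: "k < length p"
  have *: "measurable_mat M (p ! k) (p ! k) (\<lambda>w. snd (F w) ! k * snd (G w) ! k)"
    by (rule measurable_mat_mult[OF measurable_param_mat[OF F k] measurable_param_mat[OF G k]])
  show "measurable_mat M (p ! k) (p ! k) (\<lambda>w. snd (param_mult (F w) (G w)) ! k)"
    by (rule measurable_mat_cong[THEN iffD1, OF _ *]) (use in_group k in \<open>simp add: param_mult_nth[where p = p]\<close>)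
qed

lemma measurable_haar_density [measurable]: "haar_density p \<in> borel_measurable (param_borel p)"
proof -
  have "(\<lambda>S. \<Prod>k<length p. \<Prod>i\<in>{1..<p ! k}. ((snd S ! k) $$ (i, i)) ^ (i - 1)) \<in> borel_measurable (param_borel p)"
    by (intro borel_measurable_prod borel_measurable_power measurable_param_entry) auto
  then show ?thesis unfolding haar_density_def by measurable
qed

lemma measurable_act_mat:
  assumes F: "F \<in> M \<rightarrow>\<^sub>M param_borel p"
  shows "measurable_mat M (prod_list (p @ [n])) (prod_list (p @ [n])) (\<lambda>w. act_mat n (F w))"
proof -
  let ?N = "prod_list (p @ [n])"
  let ?Gs = "map (\<lambda>k w. snd (F w) ! k) [0..<length p] @ [\<lambda>_. 1\<^sub>m n]"
  have "list_all2 (\<lambda>G q. measurable_mat M q q G) ?Gs (p @ [n])"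
    by (intro list_all2_appendI)
      (auto simp: list_all2_conv_all_nth measurable_mat_const intro!: measurable_param_mat[OF F])
  from measurable_mat_rev_kronecker[OF this]
  have "measurable_mat M ?N ?N (\<lambda>w. fst (F w) \<cdot>\<^sub>m rev_kronecker (map (\<lambda>G. G w) ?Gs))"
    using F by (intro measurable_mat_smult) auto
  moreover have "act_mat n (F w) = fst (F w) \<cdot>\<^sub>m rev_kronecker (map (\<lambda>G. G w) ?Gs)" if "w \<in> space M" for w
  proof -
    have "F w \<in> param_group p" using measurable_space[OF F that] by simp
    then have "map (\<lambda>k. snd (F w) ! k) [0..<length p] = snd (F w)"
      by (metis map_nth param_group_length)
    then show ?thesis by (simp add: act_mat_def comp_def)
  qed
  ultimately show ?thesis by (simp add: measurable_mat_cong[of M "\<lambda>w. act_mat n (F w)"])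
qed

lemma sets_array_lebesgue: "sets (array_lebesgue d) = sets (PiM (array_index d) (\<lambda>_. borel))"
  unfolding array_lebesgue_def by (intro sets_PiM_cong) auto

lemma measurable_array_component:
  assumes "is \<in> array_index d"
  shows "(\<lambda>X. X is) \<in> borel_measurable (array_lebesgue d)"
  using measurable_component_singleton[OF assms, of "\<lambda>_. borel :: real measure"]
  by (simp add: measurable_cong_sets[OF sets_array_lebesgue refl])

lemma measurable_array_lebesgueI:
  assumes "\<And>w. w \<in> space M \<Longrightarrow> F w \<in> extensional (array_index d)"
    and "\<And>is. is \<in> array_index d \<Longrightarrow> (\<lambda>w. F w is) \<in> borel_measurable M"
  shows "F \<in> M \<rightarrow>\<^sub>M array_lebesgue d"
proof -
  have "(\<lambda>w. \<lambda>is\<in>array_index d. F w is) \<in> M \<rightarrow>\<^sub>M PiM (array_index d) (\<lambda>_. borel)"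
    by (intro measurable_restrict assms)
  then have "F \<in> M \<rightarrow>\<^sub>M PiM (array_index d) (\<lambda>_. borel)"
    using assms(1) by (subst measurable_cong[of _ _ "\<lambda>w. \<lambda>is\<in>array_index d. F w is"])
      (auto simp: extensional_restrict)
  then show ?thesis by (simp add: measurable_cong_sets[OF refl sets_array_lebesgue])
qed

lemma measurable_array_act [measurable]:
  assumes F: "F \<in> M \<rightarrow>\<^sub>M param_borel p" and X: "X \<in> M \<rightarrow>\<^sub>M array_lebesgue (p @ [n])"
  shows "(\<lambda>w. array_act p n (F w) (X w)) \<in> M \<rightarrow>\<^sub>M array_lebesgue (p @ [n])"
proof (rule measurable_array_lebesgueI)
  have in_group: "F w \<in> param_group p" if "w \<in> space M" for w
    using measurable_space[OF F that] by auto
  show "array_act p n (F w) (X w) \<in> extensional (array_index (p @ [n]))" if "w \<in> space M" for w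
    using in_group[OF that] by (simp add: array_act_eq array_of_vec_def)
  fix "is" assume i: "is \<in> array_index (p @ [n])"
  note lt = vec_pos_less[OF i]
  have "(\<lambda>w. \<Sum>t\<le>vec_pos (p @ [n]) is. act_mat n (F w) $$ (vec_pos (p @ [n]) is, t)
      * X w (multi_index (p @ [n]) t)) \<in> borel_measurable M"
    using lt by (intro borel_measurable_sum borel_measurable_times measurable_matD(2)[OF measurable_act_mat[OF F]]
      measurable_compose[OF X measurable_array_component] multi_index_in) auto
  then show "(\<lambda>w. array_act p n (F w) (X w) is) \<in> borel_measurable M"
    by (subst measurable_cong[OF array_act_apply[OF in_group i]])
qed

lemma measurable_likelihood [measurable]:
  assumes F: "F \<in> M \<rightarrow>\<^sub>M param_borel p" and X: "X \<in> M \<rightarrow>\<^sub>M array_lebesgue (p @ [n])"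
  shows "(\<lambda>w. likelihood p n (F w) (X w)) \<in> borel_measurable M"
proof -
  let ?N = "prod_list (p @ [n])"
  have in_group: "F w \<in> param_group p" if "w \<in> space M" for w
    using measurable_space[OF F that] by auto
  have inv: "measurable_mat M ?N ?N (\<lambda>w. mat_inv (act_mat n (F w)))"
    using det_act_mat[OF in_group] param_groupD(1)[OF in_group]
    by (intro measurable_mat_inv measurable_act_mat[OF F]) force
  define q where "q w i = (\<Sum>t<?N. mat_inv (act_mat n (F w)) $$ (i, t) * X w (multi_index (p @ [n]) t))" for w i
  have q [measurable]: "(\<lambda>w. q w i) \<in> borel_measurable M" if "i < ?N" for i
    unfolding q_def using that
    by (intro borel_measurable_sum borel_measurable_times measurable_matD(2)[OF inv]
      measurable_compose[OF X measurable_array_component] multi_index_in) auto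
  have "mat_inv (act_mat n (F w)) *\<^sub>v array_vec (p @ [n]) (X w) = Matrix.vec ?N (q w)"
    if "w \<in> space M" for w
    using measurable_matD(1)[OF inv that]
    by (intro eq_vecI) (auto simp: q_def scalar_prod_def array_vec_def lessThan_atLeast0 simp del: prod_list.append intro!: sum.cong)
  then have "likelihood p n (F w) (X w)
      = inverse (fst (F w)) ^ ?N * exp (- (\<Sum>i<?N. q w i * q w i) / 2)" if "w \<in> space M" for w
    unfolding likelihood_def using that by (simp add: scalar_prod_def lessThan_atLeast0 del: prod_list.append)
  moreover have "(\<lambda>w. inverse (fst (F w)) ^ ?N * exp (- (\<Sum>i<?N. q w i * q w i) / 2)) \<in> borel_measurable M"
    using F q by (intro borel_measurable_times borel_measurable_power borel_measurable_exp measurable_compose[OF _ borel_measurable_exp]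
      borel_measurable_divide borel_measurable_uminus borel_measurable_sum borel_measurable_inverse) auto
  ultimately show ?thesis
    using measurable_cong[of M "\<lambda>w. likelihood p n (F w) (X w)"] by simp
qed

section \<open>Triangular changes of variables\<close>

definition tri_map :: "'i set \<Rightarrow> ('i \<Rightarrow> real) \<Rightarrow> ('i \<Rightarrow> ('i \<Rightarrow> real) \<Rightarrow> real) \<Rightarrow> ('i \<Rightarrow> real) \<Rightarrow> 'i \<Rightarrow> real" where
  "tri_map I a g x = (\<lambda>i\<in>I. a i * x i + g i x)"

lemma measurable_tri_map:
  assumes "\<And>i. i \<in> I \<Longrightarrow> g i \<in> borel_measurable (PiM I (\<lambda>_. lborel))"
  shows "tri_map I a g \<in> PiM I (\<lambda>_. lborel) \<rightarrow>\<^sub>M PiM I (\<lambda>_. lborel)"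
  unfolding tri_map_def
proof (rule measurable_restrict)
  fix i assume "i \<in> I"
  then show "(\<lambda>x. a i * x i + g i x) \<in> PiM I (\<lambda>_. lborel) \<rightarrow>\<^sub>M lborel"
    using measurable_component_singleton[of i I "\<lambda>_. lborel :: real measure"] assms[of i] by simp
qed

lemma nn_integral_tri_map:
  fixes r :: "'i \<Rightarrow> nat"
  assumes "finite I" and "\<And>i. i \<in> I \<Longrightarrow> a i \<noteq> 0"
    and "\<And>i. i \<in> I \<Longrightarrow> g i \<in> borel_measurable (PiM I (\<lambda>_. lborel))"
    and "\<And>i x y. i \<in> I \<Longrightarrow> (\<And>j. j \<in> I \<Longrightarrow> r j < r i \<Longrightarrow> x j = y j) \<Longrightarrow> g i x = g i y"
    and "F \<in> borel_measurable (PiM I (\<lambda>_. lborel))"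
  shows "(\<integral>\<^sup>+ x. F x \<partial>PiM I (\<lambda>_. lborel))
    = ennreal (\<Prod>i\<in>I. \<bar>a i\<bar>) * (\<integral>\<^sup>+ x. F (tri_map I a g x) \<partial>PiM I (\<lambda>_. lborel))"
  using assms
proof (induction I arbitrary: F rule: finite_ranking_induct[where f = r])
  case empty
  have "tri_map {} a g x = x" if "x \<in> space (PiM {} (\<lambda>_. lborel :: real measure))" for x
    using that by (auto simp: tri_map_def space_PiM)
  then show ?case by (simp cong: nn_integral_cong)
next
  case (insert i I)
  show ?case
  proof (cases "i \<in> I")
    case True
    then have I: "insert i I = I" by blast
    show ?thesis unfolding I by (rule insert.IH[OF insert.prems[unfolded I]])
  next
    case False
    interpret product_sigma_finite "\<lambda>_. lborel :: real measure" by standard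
    note [measurable] = \<open>F \<in> borel_measurable (PiM (insert i I) (\<lambda>_. lborel))\<close>
    have I: "finite I" "i \<notin> I" using insert.hyps False by auto
    note a = insert.prems(1) and g = insert.prems(2) and dep = insert.prems(3)
    have upd [measurable]: "(\<lambda>x. x(i := 0)) \<in> PiM I (\<lambda>_. lborel) \<rightarrow>\<^sub>M PiM (insert i I) (\<lambda>_. lborel :: real measure)"
      by measurable
    have g_upd: "g j (x(i := y)) = g j x" if "j \<in> insert i I" for j x y
      using that insert.hyps(2) by (intro dep) fastforce+
    have g' [measurable]: "g j \<in> borel_measurable (PiM I (\<lambda>_. lborel))" if "j \<in> insert i I" for j
      using measurable_compose[OF upd g[OF that]] by (simp only: g_upd[OF that])
    define H where "H x = (\<integral>\<^sup>+ y. F (x(i := y)) \<partial>lborel)" for x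
    have H [measurable]: "H \<in> borel_measurable (PiM I (\<lambda>_. lborel))"
      unfolding H_def by measurable
    note T [measurable] = measurable_tri_map[of "insert i I" g a, OF g]
    have aff: "H (tri_map I a g x) = ennreal \<bar>a i\<bar> * (\<integral>\<^sup>+ y. F (tri_map (insert i I) a g (x(i := y))) \<partial>lborel)"
      if x: "x \<in> space (PiM I (\<lambda>_. lborel :: real measure))" for x
    proof -
      have "tri_map I a g x \<in> space (PiM I (\<lambda>_. lborel :: real measure))"
        by (auto simp: tri_map_def space_PiM)
      then have "(\<lambda>y. F ((tri_map I a g x)(i := y))) \<in> borel_measurable lborel"
        by measurable
      then have "H (tri_map I a g x)
          = ennreal \<bar>a i\<bar> * (\<integral>\<^sup>+ y. F ((tri_map I a g x)(i := g i x + a i * y)) \<partial>lborel)"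
        unfolding H_def using a by (subst nn_integral_real_affine[where c = "a i" and t = "g i x"]) auto
      moreover have "(tri_map I a g x)(i := g i x + a i * y) = tri_map (insert i I) a g (x(i := y))" for y
        using I by (auto simp: tri_map_def g_upd fun_eq_iff)
      ultimately show ?thesis by simp
    qed
    have "(\<integral>\<^sup>+ x. F x \<partial>PiM (insert i I) (\<lambda>_. lborel)) = (\<integral>\<^sup>+ x. H x \<partial>PiM I (\<lambda>_. lborel))"
      unfolding H_def by (rule product_nn_integral_insert[OF I]) fact
    also have "\<dots> = ennreal (\<Prod>j\<in>I. \<bar>a j\<bar>) * (\<integral>\<^sup>+ x. H (tri_map I a g x) \<partial>PiM I (\<lambda>_. lborel))"
    proof (rule insert.IH)
      fix j and x y :: "'i \<Rightarrow> real" assume j: "j \<in> I" and eq: "\<And>l. l \<in> I \<Longrightarrow> r l < r j \<Longrightarrow> x l = y l"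
      show "g j x = g j y"
      proof (rule dep)
        fix l assume "l \<in> insert i I" "r l < r j"
        then show "x l = y l" using eq[of l] insert.hyps(2)[OF j] by auto
      qed (use j in simp)
    qed (use H a in \<open>auto intro: g'\<close>)
    also have "(\<integral>\<^sup>+ x. H (tri_map I a g x) \<partial>PiM I (\<lambda>_. lborel))
        = (\<integral>\<^sup>+ x. ennreal \<bar>a i\<bar> * (\<integral>\<^sup>+ y. F (tri_map (insert i I) a g (x(i := y))) \<partial>lborel) \<partial>PiM I (\<lambda>_. lborel))"
      by (intro nn_integral_cong aff)
    also have "\<dots> = ennreal \<bar>a i\<bar> * (\<integral>\<^sup>+ x. (\<integral>\<^sup>+ y. F (tri_map (insert i I) a g (x(i := y))) \<partial>lborel) \<partial>PiM I (\<lambda>_. lborel))"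
      by (rule nn_integral_cmult) measurable
    also have "(\<integral>\<^sup>+ x. (\<integral>\<^sup>+ y. F (tri_map (insert i I) a g (x(i := y))) \<partial>lborel) \<partial>PiM I (\<lambda>_. lborel))
        = (\<integral>\<^sup>+ x. F (tri_map (insert i I) a g x) \<partial>PiM (insert i I) (\<lambda>_. lborel))"
      by (rule product_nn_integral_insert[OF I, symmetric]) measurable
    finally show ?thesis
      using I by (simp add: ennreal_mult prod_nonneg mult.assoc[symmetric] mult.commute)
  qed
qed

lemma nn_integral_scale_tri_map:
  fixes r :: "'i \<Rightarrow> nat"
  assumes I: "finite I" and a: "\<And>i. i \<in> I \<Longrightarrow> a i \<noteq> 0"
    and g: "\<And>i. i \<in> I \<Longrightarrow> g i \<in> borel_measurable (PiM I (\<lambda>_. lborel))"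
    and dep: "\<And>i x y. i \<in> I \<Longrightarrow> (\<And>j. j \<in> I \<Longrightarrow> r j < r i \<Longrightarrow> x j = y j) \<Longrightarrow> g i x = g i y"
    and b: "b \<noteq> 0"
    and F [measurable]: "F \<in> borel_measurable (lborel \<Otimes>\<^sub>M PiM I (\<lambda>_. lborel))"
  shows "(\<integral>\<^sup>+ x. F x \<partial>(lborel \<Otimes>\<^sub>M PiM I (\<lambda>_. lborel)))
    = ennreal (\<bar>b\<bar> * (\<Prod>i\<in>I. \<bar>a i\<bar>))
      * (\<integral>\<^sup>+ x. F (b * fst x, tri_map I a g (snd x)) \<partial>(lborel \<Otimes>\<^sub>M PiM I (\<lambda>_. lborel)))"
proof -
  interpret product_sigma_finite "\<lambda>_. lborel :: real measure" by standard
  interpret P: sigma_finite_measure "PiM I (\<lambda>_. lborel :: real measure)" by (rule sigma_finite[OF I])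
  note T [measurable] = measurable_tri_map[of I g a, OF g]
  have "(\<integral>\<^sup>+ x. F x \<partial>(lborel \<Otimes>\<^sub>M PiM I (\<lambda>_. lborel)))
      = (\<integral>\<^sup>+ s. \<integral>\<^sup>+ c. F (s, c) \<partial>PiM I (\<lambda>_. lborel) \<partial>lborel)"
    by (rule P.nn_integral_fst[symmetric]) fact
  also have "\<dots> = ennreal \<bar>b\<bar> * (\<integral>\<^sup>+ s. \<integral>\<^sup>+ c. F (b * s, c) \<partial>PiM I (\<lambda>_. lborel) \<partial>lborel)"
    using b by (subst nn_integral_real_affine[where c = b and t = 0]) auto
  also have "(\<integral>\<^sup>+ s. \<integral>\<^sup>+ c. F (b * s, c) \<partial>PiM I (\<lambda>_. lborel) \<partial>lborel)
      = (\<integral>\<^sup>+ s. ennreal (\<Prod>i\<in>I. \<bar>a i\<bar>) * (\<integral>\<^sup>+ c. F (b * s, tri_map I a g c) \<partial>PiM I (\<lambda>_. lborel)) \<partial>lborel)"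
    by (intro nn_integral_cong nn_integral_tri_map[where r = r] I a g dep) auto
  also have "\<dots> = ennreal (\<Prod>i\<in>I. \<bar>a i\<bar>) * (\<integral>\<^sup>+ s. (\<integral>\<^sup>+ c. F (b * s, tri_map I a g c) \<partial>PiM I (\<lambda>_. lborel)) \<partial>lborel)"
    by (rule nn_integral_cmult) measurable
  also have "(\<integral>\<^sup>+ s. (\<integral>\<^sup>+ c. F (b * s, tri_map I a g c) \<partial>PiM I (\<lambda>_. lborel)) \<partial>lborel)
      = (\<integral>\<^sup>+ x. F (b * fst x, tri_map I a g (snd x)) \<partial>(lborel \<Otimes>\<^sub>M PiM I (\<lambda>_. lborel)))"
    by (subst P.nn_integral_fst[symmetric]) auto
  finally show ?thesis by (simp add: ennreal_mult prod_nonneg mult.assoc)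
qed

lemma nn_integral_array_act:
  assumes A: "A \<in> param_group p" and F: "F \<in> borel_measurable (array_lebesgue (p @ [n]))"
  shows "(\<integral>\<^sup>+ X. F X \<partial>array_lebesgue (p @ [n]))
    = ennreal (fst A ^ prod_list (p @ [n])) * (\<integral>\<^sup>+ X. F (array_act p n A X) \<partial>array_lebesgue (p @ [n]))"
proof -
  let ?d = "p @ [n]" and ?M = "act_mat n A"
  let ?P = "PiM (array_index ?d) (\<lambda>_. lborel :: real measure)"
  define a where "a is = ?M $$ (vec_pos ?d is, vec_pos ?d is)" for "is"
  define g where "g is X = (\<Sum>t<vec_pos ?d is. ?M $$ (vec_pos ?d is, t) * X (multi_index ?d t))"
    for "is" and X :: array
  have pos: "0 < ?M $$ (t, t)" if "t < prod_list ?d" for t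
    using act_mat_diag_pos[OF A that] .
  have a_pos: "0 < a is" if "is \<in> array_index ?d" for "is"
    unfolding a_def using pos vec_pos_less that by blast
  have "(\<Prod>is\<in>array_index ?d. \<bar>a is\<bar>) = (\<Prod>t<prod_list ?d. \<bar>?M $$ (t, t)\<bar>)"
    unfolding a_def by (rule prod.reindex_bij_betw[OF bij_betw_vec_pos])
  also have "\<dots> = (\<Prod>t<prod_list ?d. ?M $$ (t, t))"
    using pos by (intro prod.cong) (auto simp: less_imp_le simp del: prod_list.append)
  also have "\<dots> = fst A ^ prod_list ?d"
    using det_lower_tri[OF act_mat_carrier[OF A]] act_mat_lower[OF A] det_act_mat[OF A] by auto
  finally have prod: "(\<Prod>is\<in>array_index ?d. \<bar>a is\<bar>) = fst A ^ prod_list ?d" .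
  have act: "array_act p n A X = tri_map (array_index ?d) a g X" for X
  proof
    fix "is"
    show "array_act p n A X is = tri_map (array_index ?d) a g X is"
    proof (cases "is \<in> array_index ?d")
      case True
      then show ?thesis
        by (simp add: array_act_apply[OF A] tri_map_def a_def g_def multi_index_vec_pos lessThan_Suc_atMost[symmetric])
    qed (auto simp: array_act_eq[OF A] array_of_vec_def tri_map_def)
  qed
  have g: "g is \<in> borel_measurable ?P" if "is \<in> array_index ?d" for "is"
    unfolding g_def array_lebesgue_def[symmetric] using vec_pos_less[OF that]
    by (intro borel_measurable_sum borel_measurable_times measurable_array_component multi_index_in)
      auto
  show ?thesis
    unfolding act array_lebesgue_def prod[symmetric]
  proof (rule nn_integral_tri_map[where r = "vec_pos ?d"])
    fix "is" and x y :: array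
    assume i: "is \<in> array_index ?d"
      and eq: "\<And>j. j \<in> array_index ?d \<Longrightarrow> vec_pos ?d j < vec_pos ?d is \<Longrightarrow> x j = y j"
    show "g is x = g is y"
      unfolding g_def
    proof (rule sum.cong)
      fix t assume "t \<in> {..<vec_pos ?d is}"
      then show "?M $$ (vec_pos ?d is, t) * x (multi_index ?d t) = ?M $$ (vec_pos ?d is, t) * y (multi_index ?d t)"
        using vec_pos_less[OF i] eq[of "multi_index ?d t"] multi_index_in[of t ?d] vec_pos_multi_index[of t ?d] by auto
    qed simp
  qed (use g a_pos F in \<open>auto simp: array_lebesgue_def order_less_imp_not_eq2\<close>)
qed

lemma AE_array_act:
  assumes A: "A \<in> param_group p" and ae: "AE X in array_lebesgue (p @ [n]). P X"
  shows "AE X in array_lebesgue (p @ [n]). P (array_act p n A X)"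
proof -
  let ?L = "array_lebesgue (p @ [n])"
  from ae obtain N where N: "{X \<in> space ?L. \<not> P X} \<subseteq> N" "N \<in> sets ?L" "emeasure ?L N = 0"
    by (auto elim!: AE_E)
  have act [measurable]: "array_act p n A \<in> ?L \<rightarrow>\<^sub>M ?L"
    using A by (intro measurable_array_act) auto
  have "0 = (\<integral>\<^sup>+ X. indicator N X \<partial>?L)" using N by simp
  also have "\<dots> = ennreal (fst A ^ prod_list (p @ [n])) * (\<integral>\<^sup>+ X. indicator N (array_act p n A X) \<partial>?L)"
    using N(2) by (intro nn_integral_array_act[OF A]) auto
  finally have "(\<integral>\<^sup>+ X. indicator N (array_act p n A X) \<partial>?L) = 0"
    using param_groupD(1)[OF A] by (auto simp: ennreal_zero_less_mult_iff)
  then have "AE X in ?L. indicator N (array_act p n A X) = (0 :: ennreal)"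
    using N(2) by (subst (asm) nn_integral_0_iff_AE) auto
  then show ?thesis
    by (rule AE_mp) (use N(1) measurable_space[OF act] in \<open>auto simp: indicator_def intro!: AE_I2\<close>)
qed

section \<open>The right Haar measure\<close>

abbreviation coord_lebesgue :: "nat list \<Rightarrow> (real \<times> (nat \<times> nat \<times> nat \<Rightarrow> real)) measure" where
  "coord_lebesgue p \<equiv> lborel \<Otimes>\<^sub>M PiM (coord_index p) (\<lambda>_. lborel)"

definition coord_mat :: "nat list \<Rightarrow> (nat \<times> nat \<times> nat \<Rightarrow> real) \<Rightarrow> nat \<Rightarrow> real mat" where
  "coord_mat p c k = mat (p ! k) (p ! k) (\<lambda>(i, j).
     if i = 0 \<and> j = 0 then \<Prod>l\<in>{1..<p ! k}. inverse (c (k, l, l))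
     else if j \<le> i then c (k, i, j) else 0)"

definition haar :: "nat list \<Rightarrow> param measure" where
  "haar p = density (param_lebesgue p) (\<lambda>S. ennreal (haar_density p S))"

definition coords_of :: "nat list \<Rightarrow> param \<Rightarrow> real \<times> (nat \<times> nat \<times> nat \<Rightarrow> real)" where
  "coords_of p S = (fst S, \<lambda>(k, i, j)\<in>coord_index p. (snd S ! k) $$ (i, j))"

lemma param_of_coords_eq:
  "param_of_coords p x = (fst x, map (coord_mat p (snd x)) [0..<length p])"
  by (cases x) (simp add: param_of_coords_def coord_mat_def)

lemma coord_index_Sigma:
  "coord_index p = (SIGMA k:{..<length p}. SIGMA i:{1..<p ! k}. {..i})"
  by (auto simp: coord_index_def)

lemma finite_coord_index [simp]: "finite (coord_index p)"
  by (simp add: coord_index_Sigma)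

lemma coord_mat_carrier [simp]: "coord_mat p c k \<in> carrier_mat (p ! k) (p ! k)"
  by (simp add: coord_mat_def)

lemma coord_mat_index: "(k, i, j) \<in> coord_index p \<Longrightarrow> coord_mat p c k $$ (i, j) = c (k, i, j)"
  by (auto simp: coord_mat_def coord_index_def)

lemma coord_mat_in:
  assumes "x \<in> coord_domain p" "k < length p"
  shows "coord_mat p (snd x) k \<in> lower_tri_group (p ! k)"
proof (rule lower_tri_groupI)
  have pos: "0 < snd x (k, i, i)" if "1 \<le> i" "i < p ! k" for i
  proof -
    have "(k, i, i) \<in> coord_index p" using assms that by (auto simp: coord_index_def)
    then show ?thesis using assms by (auto simp: coord_domain_def)
  qed
  have pos': "0 < (\<Prod>l\<in>{1..<p ! k}. inverse (snd x (k, l, l)))"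
    using pos by (intro prod_pos) auto
  show "0 < coord_mat p (snd x) k $$ (i, i)" if "i < p ! k" for i
    using that pos[of i] pos' by (cases "i = 0") (auto simp: coord_mat_def)
  show "(\<Prod>i<p ! k. coord_mat p (snd x) k $$ (i, i)) = 1"
  proof (cases "p ! k = 0")
    case False
    have "(\<Prod>i<p ! k. coord_mat p (snd x) k $$ (i, i))
        = coord_mat p (snd x) k $$ (0, 0) * (\<Prod>i\<in>{1..<p ! k}. coord_mat p (snd x) k $$ (i, i))"
      using False by (simp add: lessThan_atLeast0 prod.atLeast_Suc_lessThan)
    also have "\<dots> = (\<Prod>l\<in>{1..<p ! k}. inverse (snd x (k, l, l))) * (\<Prod>i\<in>{1..<p ! k}. snd x (k, i, i))"
      using False by (simp add: coord_mat_def)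
    also have "\<dots> = (\<Prod>l\<in>{1..<p ! k}. inverse (snd x (k, l, l)) * snd x (k, l, l))"
      by (simp only: prod.distrib)
    also have "\<dots> = 1"
    proof (rule prod.neutral, rule ballI)
      fix l assume "l \<in> {1..<p ! k}"
      then show "inverse (snd x (k, l, l)) * snd x (k, l, l) = 1" using pos[of l] by simp
    qed
    finally show ?thesis .
  qed simp
qed (auto simp: coord_mat_def)

lemma param_of_coords_in: "x \<in> coord_domain p \<Longrightarrow> param_of_coords p x \<in> param_group p"
  by (auto simp: param_of_coords_eq param_group_iff list_all2_conv_all_nth coord_mat_in)
    (auto simp: coord_domain_def)

lemma coord_domain_eq: "coord_domain p = {x \<in> space (coord_lebesgue p).
    0 < fst x \<and> (\<forall>t\<in>coord_index p. fst (snd t) = snd (snd t) \<longrightarrow> 0 < snd x t)}"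
  by (auto simp: coord_domain_def space_pair_measure space_PiM PiE_def)

lemma measurable_coord [measurable]:
  "t \<in> coord_index p \<Longrightarrow> (\<lambda>x. snd x t) \<in> borel_measurable (coord_lebesgue p)"
  using measurable_compose[OF measurable_snd measurable_component_singleton[of t "coord_index p" "\<lambda>_. lborel :: real measure"]]
  by (simp add: measurable_lborel1)

lemma sets_coord_domain [measurable]: "coord_domain p \<in> sets (coord_lebesgue p)"
proof -
  have "{x \<in> space (coord_lebesgue p). 0 < snd x t} \<in> sets (coord_lebesgue p)"
    if "t \<in> coord_index p" for t
    by (rule borel_measurable_less[OF borel_measurable_const measurable_coord[OF that]])
  then have "{x \<in> space (coord_lebesgue p). \<forall>t\<in>coord_index p. fst (snd t) = snd (snd t) \<longrightarrow> 0 < snd x t}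
      \<in> sets (coord_lebesgue p)"
    by (intro sets.sets_Collect_finite_All finite_coord_index sets.sets_Collect_imp sets.sets_Collect_const)
  moreover have "{x \<in> space (coord_lebesgue p). 0 < fst x} \<in> sets (coord_lebesgue p)"
    by (intro borel_measurable_less borel_measurable_const) simp
  ultimately show ?thesis
    unfolding coord_domain_eq by (intro sets.sets_Collect_conj)
qed

lemma emeasure_coord_domain: "emeasure (coord_lebesgue p) (coord_domain p) \<noteq> 0"
proof -
  interpret product_sigma_finite "\<lambda>_. lborel :: real measure" by standard
  interpret P: sigma_finite_measure "PiM (coord_index p) (\<lambda>_. lborel :: real measure)"
    by (rule sigma_finite) simp
  define B where "B = (\<Pi>\<^sub>E t\<in>coord_index p. {0<..<1::real})"
  have B: "B \<in> sets (PiM (coord_index p) (\<lambda>_. lborel))"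
    unfolding B_def by (intro sets_PiM_I_finite) auto
  have "emeasure (PiM (coord_index p) (\<lambda>_. lborel)) B = 1"
    unfolding B_def by (subst emeasure_PiM) auto
  then have "emeasure (coord_lebesgue p) ({0<..<1} \<times> B) = 1"
    using B by (subst P.emeasure_pair_measure_Times) auto
  moreover have "{0<..<1} \<times> B \<subseteq> coord_domain p"
    by (auto simp: coord_domain_def B_def PiE_def)
  then have "emeasure (coord_lebesgue p) ({0<..<1} \<times> B) \<le> emeasure (coord_lebesgue p) (coord_domain p)"
    by (rule emeasure_mono) measurable
  ultimately show ?thesis by auto
qed

lemma measurable_coord_mat:
  assumes "k < length p" "i < p ! k" "j < p ! k"
  shows "(\<lambda>c. coord_mat p c k $$ (i, j)) \<in> borel_measurable (PiM (coord_index p) (\<lambda>_. lborel))"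
proof -
  have c: "(\<lambda>c. c t :: real) \<in> borel_measurable (PiM (coord_index p) (\<lambda>_. lborel))" if "t \<in> coord_index p" for t
    using measurable_component_singleton[OF that, of "\<lambda>_. lborel :: real measure"] by simp
  consider "i = 0 \<and> j = 0" | "\<not> (i = 0 \<and> j = 0)" "j \<le> i" | "i < j" by linarith
  then show ?thesis
  proof cases
    case 1
    then have "(\<lambda>c. coord_mat p c k $$ (i, j)) = (\<lambda>c. \<Prod>l\<in>{1..<p ! k}. inverse (c (k, l, l)))"
      using assms by (simp add: coord_mat_def)
    moreover have "(k, l, l) \<in> coord_index p" if "l \<in> {1..<p ! k}" for l
      using that assms by (auto simp: coord_index_def)
    ultimately show ?thesis by (auto intro!: borel_measurable_prod borel_measurable_inverse c)
  next
    case 2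
    then have "(k, i, j) \<in> coord_index p" using assms by (auto simp: coord_index_def)
    then show ?thesis by (simp add: coord_mat_index c)
  next
    case 3
    then show ?thesis using assms by (simp add: coord_mat_def)
  qed
qed

lemma measurable_param_of_coords:
  "param_of_coords p \<in> restrict_space (coord_lebesgue p) (coord_domain p) \<rightarrow>\<^sub>M param_borel p"
proof (rule measurable_param_borelI)
  show "param_of_coords p x \<in> param_group p"
    if "x \<in> space (restrict_space (coord_lebesgue p) (coord_domain p))" for x
    using that by (auto simp: space_restrict_space intro!: param_of_coords_in)
  show "(\<lambda>x. fst (param_of_coords p x)) \<in> borel_measurable (restrict_space (coord_lebesgue p) (coord_domain p))"
    by (auto simp: param_of_coords_eq intro!: measurable_restrict_space1)
  fix k assume k: "k < length p"
  have "(\<lambda>x. coord_mat p (snd x) k $$ (i, j)) \<in> borel_measurable (coord_lebesgue p)"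
    if "i < p ! k" "j < p ! k" for i j
    using measurable_compose[OF measurable_snd measurable_coord_mat[OF k that]] .
  then show "measurable_mat (restrict_space (coord_lebesgue p) (coord_domain p)) (p ! k) (p ! k)
      (\<lambda>x. snd (param_of_coords p x) ! k)"
    using k by (auto simp: measurable_mat_def param_of_coords_eq intro!: measurable_restrict_space1)
qed

lemma coords_of_param_of_coords: "x \<in> coord_domain p \<Longrightarrow> coords_of p (param_of_coords p x) = x"
  by (cases x) (auto simp: coords_of_def param_of_coords_eq fun_eq_iff coord_domain_def
      extensional_def coord_mat_index, auto simp: coord_index_def coord_mat_def)

lemma measurable_coords_of:
  "coords_of p \<in> param_borel p \<rightarrow>\<^sub>M restrict_space (coord_lebesgue p) (coord_domain p)"
proof (rule measurable_restrict_space2)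
  show "coords_of p \<in> space (param_borel p) \<rightarrow> coord_domain p"
    using param_groupD(1) lower_tri_groupD(3)[OF param_group_nth]
    by (fastforce simp: coords_of_def coord_domain_def coord_index_def)
  have "(\<lambda>S. \<lambda>(k, i, j)\<in>coord_index p. (snd S ! k) $$ (i, j)) \<in> param_borel p \<rightarrow>\<^sub>M PiM (coord_index p) (\<lambda>_. lborel)"
  proof (rule measurable_restrict)
    fix t assume "t \<in> coord_index p"
    then show "(\<lambda>S. case t of (k, i, j) \<Rightarrow> (snd S ! k) $$ (i, j)) \<in> param_borel p \<rightarrow>\<^sub>M lborel"
      using measurable_param_entry[of "fst t" p "fst (snd t)" "snd (snd t)"]
      by (auto simp: coord_index_def)
  qed
  then show "coords_of p \<in> param_borel p \<rightarrow>\<^sub>M coord_lebesgue p"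
    unfolding coords_of_def by (intro measurable_Pair) (simp_all add: measurable_param_fst)
qed

lemma sets_param_lebesgue [simp, measurable_cong]: "sets (param_lebesgue p) = sets (param_borel p)"
  by (simp add: param_lebesgue_def)

lemma space_param_lebesgue [simp]: "space (param_lebesgue p) = param_group p"
  by (simp add: param_lebesgue_def)

lemma sets_haar [simp, measurable_cong]: "sets (haar p) = sets (param_borel p)"
  by (simp add: haar_def)

lemma space_haar [simp]: "space (haar p) = param_group p"
  by (simp add: haar_def)

lemma nn_integral_param_lebesgue:
  assumes "F \<in> borel_measurable (param_borel p)"
  shows "(\<integral>\<^sup>+ S. F S \<partial>param_lebesgue p)
    = (\<integral>\<^sup>+ x. F (param_of_coords p x) * indicator (coord_domain p) x \<partial>coord_lebesgue p)"
  unfolding param_lebesgue_def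
  using assms measurable_param_of_coords sets_coord_domain
  by (subst nn_integral_distr) (auto simp: nn_integral_restrict_space)

lemma nn_integral_haar:
  assumes "F \<in> borel_measurable (param_borel p)"
  shows "(\<integral>\<^sup>+ S. F S \<partial>haar p) = (\<integral>\<^sup>+ S. ennreal (haar_density p S) * F S \<partial>param_lebesgue p)"
  unfolding haar_def using assms by (intro nn_integral_density) auto

lemma sigma_finite_param_lebesgue: "sigma_finite_measure (param_lebesgue p)"
proof -
  let ?R = "restrict_space (coord_lebesgue p) (coord_domain p)"
  interpret product_sigma_finite "\<lambda>_. lborel :: real measure" by standard
  interpret P: sigma_finite_measure "PiM (coord_index p) (\<lambda>_. lborel :: real measure)"
    by (rule sigma_finite) simp
  interpret pair_sigma_finite lborel "PiM (coord_index p) (\<lambda>_. lborel :: real measure)" ..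
  have "sigma_finite_measure (coord_lebesgue p)" ..
  then have R: "sigma_finite_measure ?R"
    by (rule sigma_finite_measure_restrict_space) measurable
  have "distr (param_lebesgue p) ?R (coords_of p) = distr ?R ?R (coords_of p \<circ> param_of_coords p)"
    unfolding param_lebesgue_def by (rule distr_distr[OF measurable_coords_of measurable_param_of_coords])
  also have "\<dots> = distr ?R ?R (\<lambda>x. x)"
    by (intro distr_cong) (auto simp: space_restrict_space coords_of_param_of_coords)
  finally have "distr (param_lebesgue p) ?R (coords_of p) = ?R" by simp
  with R show ?thesis
    using sigma_finite_measure_distr[of "param_lebesgue p" ?R "coords_of p"] measurable_coords_of
    by (simp add: measurable_cong_sets[OF sets_param_lebesgue refl])
qed

lemma sigma_finite_haar: "sigma_finite_measure (haar p)"
proof -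
  interpret sigma_finite_measure "param_lebesgue p" by (rule sigma_finite_param_lebesgue)
  show ?thesis unfolding haar_def
    by (subst sigma_finite_iff_density_finite') (auto simp: measurable_cong_sets[OF sets_param_lebesgue refl])
qed

lemma haar_nonzero: "emeasure (haar p) (param_group p) \<noteq> 0"
proof
  assume "emeasure (haar p) (param_group p) = 0"
  then have "(\<integral>\<^sup>+ S. ennreal (haar_density p S) * 1 \<partial>param_lebesgue p) = 0"
    using nn_integral_haar[of "\<lambda>_. 1" p] by (simp add: space_haar[symmetric] del: space_haar)
  then have "AE S in param_lebesgue p. ennreal (haar_density p S) = 0"
    by (subst (asm) nn_integral_0_iff_AE) (auto simp: measurable_cong_sets[OF sets_param_lebesgue refl])
  then have "AE S in param_lebesgue p. False"
    by (rule AE_mp) (auto intro!: AE_I2 simp: ennreal_eq_0_iff not_le haar_density_pos)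
  then have "emeasure (param_lebesgue p) (space (param_lebesgue p)) = 0"
    by (simp add: AE_iff_measurable[OF sets.top])
  then have "(\<integral>\<^sup>+ S. 1 \<partial>param_lebesgue p) = 0" by simp
  then show False
    using emeasure_coord_domain[of p] sets_coord_domain by (subst (asm) nn_integral_param_lebesgue) auto
qed

lemma nn_integral_param_lebesgue_subst:
  fixes r :: "nat \<times> nat \<times> nat \<Rightarrow> nat" and p :: "nat list"
  defines "I \<equiv> coord_index p"
  assumes a: "\<And>t. t \<in> I \<Longrightarrow> a t \<noteq> 0"
    and g: "\<And>t. t \<in> I \<Longrightarrow> g t \<in> borel_measurable (PiM I (\<lambda>_. lborel))"
    and dep: "\<And>t x y. t \<in> I \<Longrightarrow> (\<And>u. u \<in> I \<Longrightarrow> r u < r t \<Longrightarrow> x u = y u) \<Longrightarrow> g t x = g t y"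
    and b: "b \<noteq> 0"
    and dom: "\<And>x. x \<in> space (coord_lebesgue p) \<Longrightarrow>
      (b * fst x, tri_map I a g (snd x)) \<in> coord_domain p \<longleftrightarrow> x \<in> coord_domain p"
    and \<Phi>: "\<And>x. x \<in> coord_domain p \<Longrightarrow>
      param_of_coords p (b * fst x, tri_map I a g (snd x)) = \<Phi> (param_of_coords p x)"
    and \<Phi>_meas: "\<Phi> \<in> param_borel p \<rightarrow>\<^sub>M param_borel p"
    and F: "F \<in> borel_measurable (param_borel p)"
  shows "(\<integral>\<^sup>+ S. F S \<partial>param_lebesgue p)
    = ennreal (\<bar>b\<bar> * (\<Prod>t\<in>I. \<bar>a t\<bar>)) * (\<integral>\<^sup>+ S. F (\<Phi> S) \<partial>param_lebesgue p)"
proof -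
  define F' where "F' x = F (param_of_coords p x) * indicator (coord_domain p) x" for x
  have F': "F' \<in> borel_measurable (coord_lebesgue p)"
    unfolding F'_def
    using measurable_compose[OF measurable_param_of_coords F]
    by (subst (asm) borel_measurable_restrict_space_iff_ennreal[OF sets.Int[OF sets_coord_domain sets.top]])
      (simp add: mult.commute)
  have "(\<integral>\<^sup>+ S. F S \<partial>param_lebesgue p) = (\<integral>\<^sup>+ x. F' x \<partial>coord_lebesgue p)"
    unfolding F'_def by (rule nn_integral_param_lebesgue[OF F])
  also have "\<dots> = ennreal (\<bar>b\<bar> * (\<Prod>t\<in>I. \<bar>a t\<bar>))
      * (\<integral>\<^sup>+ x. F' (b * fst x, tri_map I a g (snd x)) \<partial>coord_lebesgue p)"
    unfolding I_def
    by (rule nn_integral_scale_tri_map[where r = r])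
      (fact finite_coord_index a[unfolded I_def] g[unfolded I_def] dep[unfolded I_def] b F')+
  also have "(\<integral>\<^sup>+ x. F' (b * fst x, tri_map I a g (snd x)) \<partial>coord_lebesgue p)
      = (\<integral>\<^sup>+ x. F (\<Phi> (param_of_coords p x)) * indicator (coord_domain p) x \<partial>coord_lebesgue p)"
  proof (rule nn_integral_cong)
    fix x assume "x \<in> space (coord_lebesgue p)"
    then show "F' (b * fst x, tri_map I a g (snd x))
        = F (\<Phi> (param_of_coords p x)) * indicator (coord_domain p) x"
      using dom[of x] \<Phi>[of x] by (cases "x \<in> coord_domain p") (auto simp: F'_def)
  qed
  also have "\<dots> = (\<integral>\<^sup>+ S. F (\<Phi> S) \<partial>param_lebesgue p)"
    by (rule nn_integral_param_lebesgue[OF measurable_compose[OF \<Phi>_meas F], symmetric])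
  finally show ?thesis .
qed

text \<open>The entry in position \<open>(0, 0)\<close> is determined by the determinant.\<close>

lemma lower_tri_group_eqI:
  assumes A: "A \<in> lower_tri_group q" and B: "B \<in> lower_tri_group q"
    and eq: "\<And>i j. 1 \<le> i \<Longrightarrow> i < q \<Longrightarrow> j \<le> i \<Longrightarrow> A $$ (i, j) = B $$ (i, j)"
  shows "A = B"
proof (rule eq_matI)
  note a = lower_tri_groupD[OF A] and b = lower_tri_groupD[OF B]
  show "dim_row A = dim_row B" "dim_col A = dim_col B" using a(1) b(1) by auto
  fix i j assume "i < dim_row B" "j < dim_col B"
  then have ij: "i < q" "j < q" using b(1) by auto
  have split: "(\<Prod>i<q. C $$ (i, i)) = C $$ (0, 0) * (\<Prod>i\<in>{1..<q}. C $$ (i, i))" for C :: "real mat"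
    using ij by (simp add: lessThan_atLeast0 prod.atLeast_Suc_lessThan)
  have "A $$ (0, 0) * (\<Prod>i\<in>{1..<q}. A $$ (i, i)) = B $$ (0, 0) * (\<Prod>i\<in>{1..<q}. B $$ (i, i))"
    unfolding split[symmetric] by (simp add: prod_diag_lower_tri[OF A] prod_diag_lower_tri[OF B])
  moreover have "(\<Prod>i\<in>{1..<q}. A $$ (i, i)) = (\<Prod>i\<in>{1..<q}. B $$ (i, i))"
    by (intro prod.cong) (auto simp: eq)
  ultimately have "A $$ (0, 0) * (\<Prod>i\<in>{1..<q}. B $$ (i, i)) = B $$ (0, 0) * (\<Prod>i\<in>{1..<q}. B $$ (i, i))"
    by (simp only:)
  moreover have "0 < (\<Prod>i\<in>{1..<q}. B $$ (i, i))" using b(3) by (intro prod_pos) auto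
  then have "(\<Prod>i\<in>{1..<q}. B $$ (i, i)) \<noteq> 0" by (rule less_imp_neq[symmetric])
  ultimately have "A $$ (0, 0) = B $$ (0, 0)" by (rule mult_right_cancel[THEN iffD1, rotated])
  then show "A $$ (i, j) = B $$ (i, j)"
    using eq[of i j] a(2) b(2) ij by (cases "i < j"; cases "i = 0") auto
qed

lemma param_group_eqI:
  assumes S: "S \<in> param_group p" and T: "T \<in> param_group p" and "fst S = fst T"
    and eq: "\<And>k i j. (k, i, j) \<in> coord_index p \<Longrightarrow> (snd S ! k) $$ (i, j) = (snd T ! k) $$ (i, j)"
  shows "S = T"
proof (rule prod_eqI)
  show "snd S = snd T"
  proof (rule nth_equalityI)
    fix k assume "k < length (snd S)"
    then have "k < length p" using param_group_length[OF S] by simp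
    then show "snd S ! k = snd T ! k"
      using eq by (intro lower_tri_group_eqI[OF param_group_nth[OF S] param_group_nth[OF T]])
        (auto simp: coord_index_def)
  qed (simp add: param_group_length[OF S] param_group_length[OF T])
qed fact

lemma param_of_coords_tri_map:
  assumes A: "A \<in> param_group p" and a: "\<And>t. t \<in> coord_index p \<Longrightarrow> 0 < a t"
    and diag: "\<And>k i c. (k, i, i) \<in> coord_index p \<Longrightarrow> g (k, i, i) c = 0"
  shows "x \<in> space (coord_lebesgue p) \<Longrightarrow>
      (fst A * fst x, tri_map (coord_index p) a g (snd x)) \<in> coord_domain p \<longleftrightarrow> x \<in> coord_domain p"
    and "x \<in> coord_domain p \<Longrightarrow> T \<in> param_group p \<Longrightarrow> fst T = fst A * fst x \<Longrightarrow>
      (\<And>k i j. (k, i, j) \<in> coord_index p \<Longrightarrow>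
        a (k, i, j) * snd x (k, i, j) + g (k, i, j) (snd x) = (snd T ! k) $$ (i, j)) \<Longrightarrow>
      param_of_coords p (fst A * fst x, tri_map (coord_index p) a g (snd x)) = T"
proof -
  have iff: "(fst A * fst x, tri_map (coord_index p) a g (snd x)) \<in> coord_domain p \<longleftrightarrow> x \<in> coord_domain p"
    if "snd x \<in> extensional (coord_index p)" for x
  proof -
    have "0 < a (k, i, i) * snd x (k, i, i) + g (k, i, i) (snd x) \<longleftrightarrow> 0 < snd x (k, i, i)"
      if "(k, i, i) \<in> coord_index p" for k i
      using a[OF that] diag[OF that] by (simp add: zero_less_mult_iff)
    then show ?thesis
      using that param_groupD(1)[OF A]
      by (cases x) (auto simp: coord_domain_def tri_map_def zero_less_mult_iff)
  qed
  show "(fst A * fst x, tri_map (coord_index p) a g (snd x)) \<in> coord_domain p \<longleftrightarrow> x \<in> coord_domain p"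
    if "x \<in> space (coord_lebesgue p)"
    using that by (intro iff) (auto simp: space_pair_measure space_PiM PiE_def)
  assume x: "x \<in> coord_domain p" and T: "T \<in> param_group p" "fst T = fst A * fst x"
    and eq: "\<And>k i j. (k, i, j) \<in> coord_index p \<Longrightarrow>
        a (k, i, j) * snd x (k, i, j) + g (k, i, j) (snd x) = (snd T ! k) $$ (i, j)"
  have "(fst A * fst x, tri_map (coord_index p) a g (snd x)) \<in> coord_domain p"
    using iff[of x] x by (auto simp: coord_domain_def)
  from param_of_coords_in[OF this] T(1)
  show "param_of_coords p (fst A * fst x, tri_map (coord_index p) a g (snd x)) = T"
  proof (rule param_group_eqI)
    fix k i j assume t: "(k, i, j) \<in> coord_index p"
    then have "k < length p" by (simp add: coord_index_def)
    then show "(snd (param_of_coords p (fst A * fst x, tri_map (coord_index p) a g (snd x))) ! k) $$ (i, j)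
        = (snd T ! k) $$ (i, j)"
      using t eq[OF t] by (simp add: param_of_coords_eq coord_mat_index tri_map_def)
  qed (use T in \<open>simp add: param_of_coords_eq\<close>)
qed

lemma prod_diag_powers:
  fixes d :: "nat \<Rightarrow> 'a::comm_semiring_1"
  shows "(\<Prod>i\<in>{1..<q}. (\<Prod>j\<le>i. d j) * d i ^ (i - 1)) = (\<Prod>j<q. d j) ^ (q - 1)"
proof (induction q)
  case (Suc q)
  show ?case
  proof (cases q)
    case (Suc m)
    have "{1..<Suc q} = insert q {1..<q}" using Suc by auto
    then have "(\<Prod>i\<in>{1..<Suc q}. (\<Prod>j\<le>i. d j) * d i ^ (i - 1))
        = (\<Prod>j\<le>q. d j) * (d q ^ m * (\<Prod>j<q. d j) ^ m)"
      using Suc.IH Suc by (simp add: mult.assoc)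
    also have "\<dots> = (\<Prod>j\<le>q. d j) ^ Suc m"
      by (simp add: lessThan_Suc_atMost[symmetric] power_mult_distrib mult_ac)
    finally show ?thesis using Suc by (simp add: lessThan_Suc_atMost)
  qed simp
qed simp

lemma nn_integral_haar_right:
  assumes A: "A \<in> param_group p" and F: "F \<in> borel_measurable (param_borel p)"
  shows "(\<integral>\<^sup>+ S. F S \<partial>haar p) = (\<integral>\<^sup>+ S. F (param_mult S A) \<partial>haar p)"
proof -
  let ?\<Phi> = "\<lambda>S. param_mult S A"
  define a where "a = (\<lambda>(k :: nat, i :: nat, j). (snd A ! k) $$ (j, j))"
  define g where "g = (\<lambda>(k, i, j) c. \<Sum>l\<in>{j<..i}. c (k :: nat, i :: nat, l) * (snd A ! k) $$ (l, j))"
  have \<Phi> [measurable]: "?\<Phi> \<in> param_borel p \<rightarrow>\<^sub>M param_borel p"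
    using A by (intro measurable_param_mult) auto
  have a_pos: "0 < a t" if "t \<in> coord_index p" for t
    using that lower_tri_groupD(3)[OF param_group_nth[OF A]] by (auto simp: a_def coord_index_def)
  have diag: "g (k, i, i) c = 0" for k i c by (simp add: g_def)
  let ?H = "\<lambda>S. ennreal (haar_density p S) * F S"
  have "?H \<in> borel_measurable (param_borel p)" using F by measurable
  from measurable_compose[OF \<Phi> this]
  have H: "(\<lambda>S. ?H (?\<Phi> S)) \<in> borel_measurable (param_lebesgue p)"
    by (simp add: measurable_cong_sets[OF sets_param_lebesgue refl])
  have "(\<integral>\<^sup>+ S. ?H S \<partial>param_lebesgue p)
      = ennreal (\<bar>fst A\<bar> * (\<Prod>t\<in>coord_index p. \<bar>a t\<bar>)) * (\<integral>\<^sup>+ S. ?H (?\<Phi> S) \<partial>param_lebesgue p)"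
  proof (rule nn_integral_param_lebesgue_subst[where r = "\<lambda>(k, i, j). i - j" and g = g])
    show "g t \<in> borel_measurable (PiM (coord_index p) (\<lambda>_. lborel))" if "t \<in> coord_index p" for t
    proof -
      obtain k i j where t: "t = (k, i, j)" by (cases t)
      have "(\<lambda>c. c (k, i, l)) \<in> borel_measurable (PiM (coord_index p) (\<lambda>_. lborel :: real measure))"
        if "l \<in> {j<..i}" for l
        using that \<open>t \<in> coord_index p\<close>
          measurable_component_singleton[of "(k, i, l)" "coord_index p" "\<lambda>_. lborel :: real measure"]
        by (auto simp: t coord_index_def)
      then show ?thesis
        unfolding g_def t by (auto intro!: borel_measurable_sum borel_measurable_times)
    qed
    show "g t x = g t y" if "t \<in> coord_index p"
      "\<And>u. u \<in> coord_index p \<Longrightarrow> (case u of (k, i, j) \<Rightarrow> i - j) < (case t of (k, i, j) \<Rightarrow> i - j) \<Longrightarrow> x u = y u"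
      for t x y
      using that by (auto simp: g_def coord_index_def intro!: sum.cong)
    show "fst A \<noteq> 0" using param_groupD(1)[OF A] by simp
    show "a t \<noteq> 0" if "t \<in> coord_index p" for t using a_pos[OF that] by simp
    show "(fst A * fst x, tri_map (coord_index p) a g (snd x)) \<in> coord_domain p \<longleftrightarrow> x \<in> coord_domain p"
      if "x \<in> space (coord_lebesgue p)" for x
      using that by (intro param_of_coords_tri_map A a_pos diag)
    show "param_of_coords p (fst A * fst x, tri_map (coord_index p) a g (snd x)) = param_mult (param_of_coords p x) A"
      if x: "x \<in> coord_domain p" for x
    proof (rule param_of_coords_tri_map(2)[where a = a and g = g, OF A a_pos diag x])
      show "param_mult (param_of_coords p x) A \<in> param_group p"
        by (intro param_mult_in param_of_coords_in x A)
      show "fst (param_mult (param_of_coords p x) A) = fst A * fst x"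
        by (simp add: param_mult_def param_of_coords_eq)
      fix k i j assume t: "(k, i, j) \<in> coord_index p"
      then have k: "k < length p" "i < p ! k" "j < p ! k" "j \<le> i" "1 \<le> i" by (auto simp: coord_index_def)
      note C = coord_mat_in[OF x k(1)] and Ak = param_group_nth[OF A k(1)]
      have "(snd (param_mult (param_of_coords p x) A) ! k) $$ (i, j) = (coord_mat p (snd x) k * snd A ! k) $$ (i, j)"
        unfolding param_mult_nth[OF param_of_coords_in[OF x] A k(1)] using k by (simp add: param_of_coords_eq)
      also have "\<dots> = (\<Sum>l\<in>{j..i}. coord_mat p (snd x) k $$ (i, l) * (snd A ! k) $$ (l, j))"
        using k by (intro lower_tri_mult_index[OF lower_tri_groupD(1,2)[OF C] lower_tri_groupD(1,2)[OF Ak]])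
      also have "\<dots> = (\<Sum>l\<in>{j..i}. snd x (k, i, l) * (snd A ! k) $$ (l, j))"
        using k by (intro sum.cong refl) (simp add: coord_mat_index coord_index_def)
      also have "\<dots> = a (k, i, j) * snd x (k, i, j) + g (k, i, j) (snd x)"
        using k by (simp add: sum.head a_def g_def mult.commute)
      finally show "a (k, i, j) * snd x (k, i, j) + g (k, i, j) (snd x)
          = (snd (param_mult (param_of_coords p x) A) ! k) $$ (i, j)" ..
    qed
  qed (use F \<Phi> in \<open>auto intro!: borel_measurable_times_ennreal\<close>)
  also have "(\<Prod>t\<in>coord_index p. \<bar>a t\<bar>)
      = (\<Prod>k<length p. \<Prod>i\<in>{1..<p ! k}. \<Prod>j\<le>i. (snd A ! k) $$ (j, j))"
    using a_pos by (simp add: coord_index_Sigma prod.Sigma[symmetric] a_def less_imp_le)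
  also have "\<bar>fst A\<bar> * \<dots> = inverse (haar_density p A)"
  proof -
    have "haar_density p A * (fst A * (\<Prod>k<length p. \<Prod>i\<in>{1..<p ! k}. \<Prod>j\<le>i. (snd A ! k) $$ (j, j)))
        = (\<Prod>k<length p. \<Prod>i\<in>{1..<p ! k}. (\<Prod>j\<le>i. (snd A ! k) $$ (j, j)) * ((snd A ! k) $$ (i, i)) ^ (i - 1))"
      using param_groupD(1)[OF A] by (simp add: haar_density_def prod.distrib)
    also have "\<dots> = 1"
      unfolding prod_diag_powers using prod_diag_lower_tri[OF param_group_nth[OF A]] by simp
    finally show ?thesis
      using param_groupD(1)[OF A] haar_density_pos[OF A] by (simp add: inverse_unique)
  qed
  also have "ennreal (inverse (haar_density p A)) * (\<integral>\<^sup>+ S. ?H (?\<Phi> S) \<partial>param_lebesgue p)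
      = (\<integral>\<^sup>+ S. ennreal (inverse (haar_density p A)) * ?H (?\<Phi> S) \<partial>param_lebesgue p)"
    by (rule nn_integral_cmult[symmetric, OF H])
  also have "\<dots> = (\<integral>\<^sup>+ S. ennreal (haar_density p S) * F (?\<Phi> S) \<partial>param_lebesgue p)"
  proof (rule nn_integral_cong)
    fix S assume "S \<in> space (param_lebesgue p)"
    then have S: "S \<in> param_group p" by simp
    have "ennreal (inverse (haar_density p A)) * ennreal (haar_density p S * haar_density p A)
        = ennreal (haar_density p S)"
      using haar_density_pos[OF A] haar_density_pos[OF S]
      by (subst ennreal_mult[symmetric]) (auto simp: field_simps)
    then show "ennreal (inverse (haar_density p A)) * ?H (?\<Phi> S) = ennreal (haar_density p S) * F (?\<Phi> S)"
      by (simp only: haar_density_mult[OF S A] mult.assoc[symmetric])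
  qed
  finally show ?thesis
    using F measurable_compose[OF \<Phi> F] by (simp add: nn_integral_haar)
qed

lemma nn_integral_haar_left:
  assumes A: "A \<in> param_group p"
  obtains \<kappa> where "0 < \<kappa>" "\<And>F. F \<in> borel_measurable (param_borel p) \<Longrightarrow>
    (\<integral>\<^sup>+ S. F S \<partial>haar p) = ennreal \<kappa> * (\<integral>\<^sup>+ S. F (param_mult A S) \<partial>haar p)"
proof -
  let ?\<Phi> = "\<lambda>S. param_mult A S"
  define a where "a = (\<lambda>(k :: nat, i :: nat, j :: nat). (snd A ! k) $$ (i, i))"
  define g where "g = (\<lambda>(k, i, j) c. \<Sum>l\<in>{j..<i}. (snd A ! k) $$ (i, l) * coord_mat p c k $$ (l, j))"
  define r where "r = (\<lambda>(k :: nat, i :: nat, j). if i = j then 0 else i)"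
  have \<Phi> [measurable]: "?\<Phi> \<in> param_borel p \<rightarrow>\<^sub>M param_borel p"
    using A by (intro measurable_param_mult) auto
  have a_pos: "0 < a t" if "t \<in> coord_index p" for t
    using that lower_tri_groupD(3)[OF param_group_nth[OF A]] by (auto simp: a_def coord_index_def)
  have diag: "g (k, i, i) c = 0" for k i c by (simp add: g_def)
  define J where "J = \<bar>fst A\<bar> * (\<Prod>t\<in>coord_index p. \<bar>a t\<bar>)"
  have "0 < (\<Prod>t\<in>coord_index p. \<bar>a t\<bar>)" using a_pos by (intro prod_pos) force
  then have J: "0 < J" using param_groupD(1)[OF A] by (simp add: J_def)
  have subst: "(\<integral>\<^sup>+ S. H S \<partial>param_lebesgue p) = ennreal J * (\<integral>\<^sup>+ S. H (?\<Phi> S) \<partial>param_lebesgue p)"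
    if H: "H \<in> borel_measurable (param_borel p)" for H
    unfolding J_def
  proof (rule nn_integral_param_lebesgue_subst[where r = r and g = g])
    show "g t \<in> borel_measurable (PiM (coord_index p) (\<lambda>_. lborel))" if "t \<in> coord_index p" for t
    proof -
      obtain k i j where t: "t = (k, i, j)" by (cases t)
      then have "k < length p" "i < p ! k" using that by (auto simp: coord_index_def)
      then show ?thesis
        unfolding g_def t by (auto intro!: borel_measurable_sum borel_measurable_times measurable_coord_mat)
    qed
    show "g t x = g t y" if t: "t \<in> coord_index p"
      and eq: "\<And>u. u \<in> coord_index p \<Longrightarrow> r u < r t \<Longrightarrow> x u = y u" for t x y
    proof -
      obtain k i j where ij: "t = (k, i, j)" by (cases t)
      have "coord_mat p x k $$ (l, j) = coord_mat p y k $$ (l, j)" if l: "l \<in> {j..<i}" for l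
      proof -
        have k: "k < length p" "i < p ! k" "j < i" "1 \<le> i" using t l by (auto simp: ij coord_index_def)
        have "x (k, m, m) = y (k, m, m)" if "m \<in> {1..<p ! k}" for m
          using that k by (intro eq) (auto simp: coord_index_def ij r_def)
        moreover have "x (k, l, j) = y (k, l, j)" if "l \<noteq> 0"
          using that k l by (intro eq) (auto simp: coord_index_def ij r_def)
        ultimately show ?thesis using k l by (auto simp: coord_mat_def)
      qed
      then show ?thesis by (simp add: g_def ij)
    qed
    show "fst A \<noteq> 0" using param_groupD(1)[OF A] by simp
    show "a t \<noteq> 0" if "t \<in> coord_index p" for t using a_pos[OF that] by simp
    show "(fst A * fst x, tri_map (coord_index p) a g (snd x)) \<in> coord_domain p \<longleftrightarrow> x \<in> coord_domain p"
      if "x \<in> space (coord_lebesgue p)" for x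
      using that by (intro param_of_coords_tri_map A a_pos diag)
    show "param_of_coords p (fst A * fst x, tri_map (coord_index p) a g (snd x)) = param_mult A (param_of_coords p x)"
      if x: "x \<in> coord_domain p" for x
    proof (rule param_of_coords_tri_map(2)[where a = a and g = g, OF A a_pos diag x])
      show "param_mult A (param_of_coords p x) \<in> param_group p"
        by (intro param_mult_in param_of_coords_in x A)
      show "fst (param_mult A (param_of_coords p x)) = fst A * fst x"
        by (simp add: param_mult_def param_of_coords_eq)
      fix k i j assume t: "(k, i, j) \<in> coord_index p"
      then have k: "k < length p" "i < p ! k" "j < p ! k" "j \<le> i" "1 \<le> i" by (auto simp: coord_index_def)
      note C = coord_mat_in[OF x k(1)] and Ak = param_group_nth[OF A k(1)]
      have "(snd (param_mult A (param_of_coords p x)) ! k) $$ (i, j) = (snd A ! k * coord_mat p (snd x) k) $$ (i, j)"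
        unfolding param_mult_nth[OF A param_of_coords_in[OF x] k(1)] using k by (simp add: param_of_coords_eq)
      also have "\<dots> = (\<Sum>l\<in>{j..i}. (snd A ! k) $$ (i, l) * coord_mat p (snd x) k $$ (l, j))"
        using k by (intro lower_tri_mult_index[OF lower_tri_groupD(1,2)[OF Ak] lower_tri_groupD(1,2)[OF C]])
      also have "\<dots> = a (k, i, j) * snd x (k, i, j) + g (k, i, j) (snd x)"
        using k by (simp add: sum.last_plus a_def g_def coord_mat_index[OF t])
      finally show "a (k, i, j) * snd x (k, i, j) + g (k, i, j) (snd x)
          = (snd (param_mult A (param_of_coords p x)) ! k) $$ (i, j)" ..
    qed
  qed (use H \<Phi> in auto)
  show ?thesis
  proof (rule that)
    show "0 < J * haar_density p A" using J haar_density_pos[OF A] by simp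
    fix F :: "param \<Rightarrow> ennreal" assume F [measurable]: "F \<in> borel_measurable (param_borel p)"
    have "(\<integral>\<^sup>+ S. F S \<partial>haar p) = ennreal J * (\<integral>\<^sup>+ S. ennreal (haar_density p (?\<Phi> S)) * F (?\<Phi> S) \<partial>param_lebesgue p)"
      unfolding nn_integral_haar[OF F] by (rule subst) measurable
    also have "(\<integral>\<^sup>+ S. ennreal (haar_density p (?\<Phi> S)) * F (?\<Phi> S) \<partial>param_lebesgue p)
        = (\<integral>\<^sup>+ S. ennreal (haar_density p A) * (ennreal (haar_density p S) * F (?\<Phi> S)) \<partial>param_lebesgue p)"
    proof (rule nn_integral_cong)
      fix S assume "S \<in> space (param_lebesgue p)"
      then have S: "S \<in> param_group p" by simp
      show "ennreal (haar_density p (?\<Phi> S)) * F (?\<Phi> S)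
          = ennreal (haar_density p A) * (ennreal (haar_density p S) * F (?\<Phi> S))"
        using haar_density_pos[OF A] haar_density_pos[OF S]
        by (simp add: haar_density_mult[OF A S] ennreal_mult mult.assoc)
    qed
    also have "\<dots> = ennreal (haar_density p A) * (\<integral>\<^sup>+ S. F (?\<Phi> S) \<partial>haar p)"
      by (subst nn_integral_haar[OF measurable_compose[OF \<Phi> F]]) (rule nn_integral_cmult, measurable)
    finally show "(\<integral>\<^sup>+ S. F S \<partial>haar p) = ennreal (J * haar_density p A) * (\<integral>\<^sup>+ S. F (?\<Phi> S) \<partial>haar p)"
      using J haar_density_pos[OF A] by (simp add: ennreal_mult mult.assoc)
  qed
qed

section \<open>Posterior loss and risk\<close>

lemma measurable_array_act_const:
  assumes "A \<in> param_group p"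
  shows "array_act p n A \<in> array_lebesgue (p @ [n]) \<rightarrow>\<^sub>M array_lebesgue (p @ [n])"
  using assms by (intro measurable_array_act) auto

lemma sigma_finite_array_lebesgue: "sigma_finite_measure (array_lebesgue d)"
proof -
  interpret product_sigma_finite "\<lambda>_. lborel :: real measure" by standard
  show ?thesis unfolding array_lebesgue_def by (rule sigma_finite) simp
qed

lemma nn_integral_likelihood_one:
  "(\<integral>\<^sup>+ X. ennreal (likelihood p n (param_one p) X) \<partial>array_lebesgue (p @ [n])) < \<infinity>"
proof -
  let ?I = "array_index (p @ [n])"
  interpret product_sigma_finite "\<lambda>_. lborel :: real measure" by standard
  have act: "act_mat n (param_one p) = 1\<^sub>m (prod_list (p @ [n]))"
    using rev_kronecker_one[of "p @ [n]"] by (simp add: act_mat_def param_one_def)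
  have "mat_inv (1\<^sub>m (prod_list (p @ [n]))) = (1\<^sub>m (prod_list (p @ [n])) :: real mat)"
    by (intro mat_inv_unique[of _ "prod_list (p @ [n])"]) auto
  then have "likelihood p n (param_one p) X = exp (- (frob_norm (p @ [n]) X)\<^sup>2 / 2)" for X
    unfolding likelihood_def act frob_norm_sq by (simp add: param_one_def del: prod_list.append)
  also have "exp (- (frob_norm (p @ [n]) X)\<^sup>2 / 2) = (\<Prod>is\<in>?I. exp (- (X is)\<^sup>2 / 2))" for X
    by (simp add: frob_norm_def sum_nonneg exp_sum[symmetric] sum_negf sum_divide_distrib)
  finally have "ennreal (likelihood p n (param_one p) X) = (\<Prod>is\<in>?I. ennreal (exp (- (X is)\<^sup>2 / 2)))" for X
    by (simp add: prod_ennreal)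
  then have "(\<integral>\<^sup>+ X. ennreal (likelihood p n (param_one p) X) \<partial>array_lebesgue (p @ [n]))
      = (\<Prod>is\<in>?I. \<integral>\<^sup>+ x. ennreal (exp (- x\<^sup>2 / 2)) \<partial>lborel)"
    unfolding array_lebesgue_def
    by (simp only:) (rule product_nn_integral_prod[of ?I "\<lambda>_ x. ennreal (exp (- x\<^sup>2 / 2))"], auto)
  also have "(\<integral>\<^sup>+ x. ennreal (exp (- x\<^sup>2 / 2)) \<partial>lborel) < \<infinity>"
  proof -
    have "(\<integral>\<^sup>+ x. ennreal (std_normal_density x) \<partial>lborel) = 1"
      by (subst nn_integral_eq_integral) auto
    moreover have "ennreal (exp (- x\<^sup>2 / 2)) = ennreal (sqrt (2 * pi)) * ennreal (std_normal_density x)" for x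
      by (simp add: std_normal_density_def ennreal_mult[symmetric])
    ultimately show ?thesis by (simp add: nn_integral_cmult)
  qed
  then have "(\<Prod>is\<in>?I. \<integral>\<^sup>+ x. ennreal (exp (- x\<^sup>2 / 2)) \<partial>lborel) < \<infinity>"
    by (simp add: power_less_top_ennreal)
  finally show ?thesis .
qed

locale invariant_problem =
  fixes p :: "nat list" and n :: nat and L :: "param \<Rightarrow> param \<Rightarrow> real"
  assumes loss: "invariant_loss p L"
begin

abbreviation "G \<equiv> param_group p"
abbreviation "\<X> \<equiv> array_lebesgue (p @ [n])"
abbreviation "lik S X \<equiv> ennreal (likelihood p n S X)"
abbreviation "loss S B \<equiv> ennreal (L S B)"

definition weighted_loss :: "array \<Rightarrow> param \<Rightarrow> ennreal" where
  "weighted_loss X B = (\<integral>\<^sup>+ S. lik S X * loss S B \<partial>haar p)"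

definition evidence :: "array \<Rightarrow> ennreal" where
  "evidence X = (\<integral>\<^sup>+ S. lik S X \<partial>haar p)"

lemma measurable_loss [measurable]:
  assumes F: "F \<in> M \<rightarrow>\<^sub>M param_borel p" and B: "B \<in> M \<rightarrow>\<^sub>M param_borel p"
  shows "(\<lambda>w. L (F w) (B w)) \<in> borel_measurable M"
proof -
  have "(\<lambda>(S, B). L S B) \<in> borel_measurable (param_borel p \<Otimes>\<^sub>M param_borel p)"
    using loss by (simp add: invariant_loss_def)
  from measurable_compose[OF measurable_Pair[OF F B] this] show ?thesis by simp
qed

lemma loss_mult:
  "A \<in> G \<Longrightarrow> S \<in> G \<Longrightarrow> B \<in> G \<Longrightarrow> L (param_mult A S) (param_mult A B) = L S B"
  using loss by (auto simp: invariant_loss_def)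

lemma posterior_loss_eq:
  assumes X: "X \<in> space \<X>" and B: "B \<in> G"
  shows "posterior_loss p n L X B = weighted_loss X B / evidence X"
proof -
  have X' [measurable]: "(\<lambda>_. X) \<in> M \<rightarrow>\<^sub>M \<X>" for M :: "param measure" using X by simp
  have B' [measurable]: "(\<lambda>_. B) \<in> M \<rightarrow>\<^sub>M param_borel p" for M :: "param measure" using B by simp
  let ?k = "\<lambda>S. ennreal (haar_density p S) * lik S X"
  have k: "ennreal (posterior_kernel p n X S) = ?k S" if "S \<in> G" for S
    using posterior_kernel_eq[OF that, of n X] haar_density_pos[OF that] likelihood_pos[OF that, of n X]
    by (simp add: ennreal_mult mult.commute)
  have Z: "(\<integral>\<^sup>+ S. ennreal (posterior_kernel p n X S) \<partial>param_lebesgue p) = evidence X"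
    unfolding evidence_def by (subst nn_integral_haar) (auto simp: k intro!: nn_integral_cong)
  have "?k \<in> borel_measurable (param_lebesgue p)" by measurable
  then have "(\<lambda>S. ennreal (posterior_kernel p n X S)) \<in> borel_measurable (param_lebesgue p)"
    by (subst measurable_cong[where g = ?k]) (auto simp: k)
  then have "posterior p n X = density (param_lebesgue p) (\<lambda>S. ?k S / evidence X)"
    unfolding posterior_def Z by (intro density_cong) (auto simp: k)
  then have "posterior_loss p n L X B = (\<integral>\<^sup>+ S. ?k S / evidence X * loss S B \<partial>param_lebesgue p)"
    unfolding posterior_loss_def by (simp only:) (rule nn_integral_density, measurable)
  also have "\<dots> = (\<integral>\<^sup>+ S. (ennreal (haar_density p S) * (lik S X * loss S B)) / evidence X \<partial>param_lebesgue p)"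
    by (simp add: divide_ennreal_def mult_ac)
  also have "\<dots> = (\<integral>\<^sup>+ S. ennreal (haar_density p S) * (lik S X * loss S B) \<partial>param_lebesgue p) / evidence X"
    by (rule nn_integral_divide) measurable
  also have "\<dots> = weighted_loss X B / evidence X"
    unfolding weighted_loss_def by (subst nn_integral_haar) auto
  finally show ?thesis .
qed

lemma evidence_pos:
  assumes X: "X \<in> space \<X>"
  shows "evidence X \<noteq> 0"
proof
  have [measurable]: "(\<lambda>_. X) \<in> M \<rightarrow>\<^sub>M \<X>" for M :: "param measure" using X by simp
  assume "evidence X = 0"
  then have "AE S in haar p. lik S X = 0"
    unfolding evidence_def by (subst (asm) nn_integral_0_iff_AE) auto
  then have "AE S in haar p. False"
    by (rule AE_mp) (auto intro!: AE_I2 simp: ennreal_eq_0_iff not_le likelihood_pos)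
  then have "emeasure (haar p) (space (haar p)) = 0"
    by (simp add: AE_iff_measurable[OF sets.top])
  then show False using haar_nonzero[of p] by simp
qed

text \<open>Left translation is quasi-invariant for the right Haar measure; its modulus cancels in the posterior.\<close>

lemma posterior_loss_act:
  assumes A: "A \<in> G" and X: "X \<in> space \<X>" and B: "B \<in> G"
  shows "posterior_loss p n L (array_act p n A X) (param_mult A B) = posterior_loss p n L X B"
proof -
  obtain \<kappa> where \<kappa>: "0 < \<kappa>" "\<And>F. F \<in> borel_measurable (param_borel p) \<Longrightarrow>
    (\<integral>\<^sup>+ S. F S \<partial>haar p) = ennreal \<kappa> * (\<integral>\<^sup>+ S. F (param_mult A S) \<partial>haar p)"
    using nn_integral_haar_left[OF A] by metis
  have AX: "array_act p n A X \<in> space \<X>"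
    using measurable_space[OF measurable_array_act_const[OF A] X] .
  have [measurable]: "(\<lambda>_. X) \<in> M \<rightarrow>\<^sub>M \<X>" "(\<lambda>_. array_act p n A X) \<in> M \<rightarrow>\<^sub>M \<X>"
    "(\<lambda>_. B) \<in> M \<rightarrow>\<^sub>M param_borel p" "(\<lambda>_. A) \<in> M \<rightarrow>\<^sub>M param_borel p"
    "(\<lambda>_. param_mult A B) \<in> M \<rightarrow>\<^sub>M param_borel p" for M :: "param measure"
    using X AX A B by simp_all
  define c where "c = inverse (fst A) ^ prod_list (p @ [n])"
  have c: "0 < c" using param_groupD(1)[OF A] by (simp add: c_def)
  define K where "K = ennreal \<kappa> * ennreal c"
  have K: "K \<noteq> 0" "K \<noteq> \<infinity>"
    using \<kappa>(1) c by (simp_all add: K_def ennreal_mult[symmetric] ennreal_eq_0_iff not_le)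
  have lik: "lik (param_mult A S) (array_act p n A X) = ennreal c * lik S X" if "S \<in> G" for S
    using c likelihood_pos[OF that, of n X] by (simp add: likelihood_act[OF A that] c_def ennreal_mult)
  have "weighted_loss (array_act p n A X) (param_mult A B)
      = ennreal \<kappa> * (\<integral>\<^sup>+ S. lik (param_mult A S) (array_act p n A X) * loss (param_mult A S) (param_mult A B) \<partial>haar p)"
    unfolding weighted_loss_def by (rule \<kappa>(2)) measurable
  also have "(\<integral>\<^sup>+ S. lik (param_mult A S) (array_act p n A X) * loss (param_mult A S) (param_mult A B) \<partial>haar p)
      = (\<integral>\<^sup>+ S. ennreal c * (lik S X * loss S B) \<partial>haar p)"
    using A B by (intro nn_integral_cong) (simp add: lik loss_mult mult.assoc)
  also have "\<dots> = ennreal c * weighted_loss X B"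
    unfolding weighted_loss_def by (rule nn_integral_cmult) measurable
  finally have w: "weighted_loss (array_act p n A X) (param_mult A B) = K * weighted_loss X B"
    by (simp add: K_def mult.assoc)
  have "evidence (array_act p n A X) = ennreal \<kappa> * (\<integral>\<^sup>+ S. lik (param_mult A S) (array_act p n A X) \<partial>haar p)"
    unfolding evidence_def by (rule \<kappa>(2)) measurable
  also have "(\<integral>\<^sup>+ S. lik (param_mult A S) (array_act p n A X) \<partial>haar p) = (\<integral>\<^sup>+ S. ennreal c * lik S X \<partial>haar p)"
    by (intro nn_integral_cong) (simp add: lik)
  also have "\<dots> = ennreal c * evidence X"
    unfolding evidence_def by (rule nn_integral_cmult) measurable
  finally have e: "evidence (array_act p n A X) = K * evidence X"
    by (simp add: K_def mult.assoc)
  show ?thesis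
    using A B K by (simp add: posterior_loss_eq X AX w e) (simp add: mult.commute[of K] divide_mult_eq)
qed

lemma posterior_argmin_act:
  assumes A: "A \<in> G" and X: "X \<in> space \<X>" and B: "B \<in> posterior_argmin p n L X"
  shows "param_mult A B \<in> posterior_argmin p n L (array_act p n A X)"
proof -
  have B': "B \<in> G" and min: "\<And>C. C \<in> G \<Longrightarrow> posterior_loss p n L X B \<le> posterior_loss p n L X C"
    using B by (auto simp: posterior_argmin_def is_arg_min_def not_less)
  have "posterior_loss p n L (array_act p n A X) (param_mult A B) \<le> posterior_loss p n L (array_act p n A X) C"
    if C: "C \<in> G" for C
  proof -
    define D where "D = param_mult (param_inv A) C"
    have D: "D \<in> G" "param_mult A D = C"
      using A C by (simp_all add: D_def param_mult_inv_cancel)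
    show ?thesis
      using min[OF D(1)] posterior_loss_act[OF A X B'] posterior_loss_act[OF A X D(1)] by (simp add: D(2))
  qed
  then show ?thesis
    using A B' by (auto simp: posterior_argmin_def is_arg_min_def not_less)
qed

lemma unique_argmin_equivariant:
  assumes min: "AE X in \<X>. \<delta> X \<in> posterior_argmin p n L X"
    and unique: "AE X in \<X>. \<exists>!B. B \<in> posterior_argmin p n L X"
  shows "equivariant p n \<delta>"
  unfolding equivariant_def
proof
  fix A assume A: "A \<in> G"
  from min unique AE_array_act[OF A min] AE_array_act[OF A unique] AE_space
  show "AE X in \<X>. \<delta> (array_act p n A X) = param_mult A (\<delta> X)"
  proof eventually_elim
    case (elim X)
    from posterior_argmin_act[OF A elim(5) elim(1)] elim(3,4) show ?case by blast
  qed
qed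

definition base_risk :: "(array \<Rightarrow> param) \<Rightarrow> ennreal" where
  "base_risk \<delta> = (\<integral>\<^sup>+ X. lik (param_one p) X * loss (param_one p) (\<delta> X) \<partial>\<X>)"

lemma nn_integral_model_shift:
  assumes S: "S \<in> G" and \<delta>: "estimator p n \<delta>" "equivariant p n \<delta>"
    and u [measurable]: "u \<in> borel_measurable \<X>"
  shows "(\<integral>\<^sup>+ X. u X * (lik S X * loss S (\<delta> X)) \<partial>\<X>)
    = (\<integral>\<^sup>+ X. u (array_act p n S X) * (lik (param_one p) X * loss (param_one p) (\<delta> X)) \<partial>\<X>)"
proof -
  have \<delta>' [measurable]: "\<delta> \<in> \<X> \<rightarrow>\<^sub>M param_borel p" using \<delta>(1) by (simp add: estimator_def)
  have [measurable]: "(\<lambda>_. S) \<in> M \<rightarrow>\<^sub>M param_borel p" "(\<lambda>_. param_one p) \<in> M \<rightarrow>\<^sub>M param_borel p"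
    for M :: "array measure" using S by simp_all
  note act [measurable] = measurable_array_act_const[OF S, of n]
  let ?N = "prod_list (p @ [n])" and ?one = "param_one p"
  have s: "0 < fst S" using param_groupD(1)[OF S] .
  have "(\<integral>\<^sup>+ X. u X * (lik S X * loss S (\<delta> X)) \<partial>\<X>)
    = ennreal (fst S ^ ?N) * (\<integral>\<^sup>+ X. u (array_act p n S X) * (lik S (array_act p n S X) * loss S (\<delta> (array_act p n S X))) \<partial>\<X>)"
    by (rule nn_integral_array_act[OF S]) measurable
  also have "\<dots> = (\<integral>\<^sup>+ X. ennreal (fst S ^ ?N) * (u (array_act p n S X) * (lik S (array_act p n S X) * loss S (\<delta> (array_act p n S X)))) \<partial>\<X>)"
    by (rule nn_integral_cmult[symmetric]) measurable
  also have "\<dots> = (\<integral>\<^sup>+ X. u (array_act p n S X) * (lik ?one X * loss ?one (\<delta> X)) \<partial>\<X>)"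
  proof (rule nn_integral_cong_AE)
    have "AE X in \<X>. \<delta> (array_act p n S X) = param_mult S (\<delta> X)"
      using \<delta>(2) S by (simp add: equivariant_def)
    with AE_space show "AE X in \<X>. ennreal (fst S ^ ?N) * (u (array_act p n S X) * (lik S (array_act p n S X) * loss S (\<delta> (array_act p n S X))))
        = u (array_act p n S X) * (lik ?one X * loss ?one (\<delta> X))"
    proof eventually_elim
      case (elim X)
      then have "\<delta> X \<in> G" using measurable_space[OF \<delta>'] by auto
      then have l: "loss S (\<delta> (array_act p n S X)) = loss ?one (\<delta> X)"
        using loss_mult[OF S param_one_in, of "\<delta> X"] S elim by simp
      have "likelihood p n S (array_act p n S X) = inverse (fst S) ^ ?N * likelihood p n ?one X"
        using likelihood_act[OF S param_one_in, of n X] S by simp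
      then have "ennreal (fst S ^ ?N) * lik S (array_act p n S X) = lik ?one X"
        using s likelihood_pos[OF param_one_in, of p n X]
        by (simp add: ennreal_mult[symmetric] power_inverse mult.assoc[symmetric] del: prod_list.append)
      then show ?case unfolding l by (metis mult.assoc mult.left_commute)
    qed
  qed
  finally show ?thesis .
qed

lemma risk_eq:
  assumes S: "S \<in> G" and \<delta>: "estimator p n \<delta>" "equivariant p n \<delta>"
  shows "risk p n L S \<delta> = ennreal (1 / sqrt ((2 * pi) ^ prod_list (p @ [n]))) * base_risk \<delta>"
proof -
  let ?c = "1 / sqrt ((2 * pi) ^ prod_list (p @ [n]))"
  have \<delta>' [measurable]: "\<delta> \<in> \<X> \<rightarrow>\<^sub>M param_borel p" using \<delta>(1) by (simp add: estimator_def)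
  have [measurable]: "(\<lambda>_. S) \<in> M \<rightarrow>\<^sub>M param_borel p" for M :: "array measure" using S by simp
  have dens: "ennreal (mvn_density (model_cov n S) (array_vec (p @ [n]) X)) = ennreal ?c * lik S X" for X
    unfolding mvn_density_model[OF S]
    using likelihood_pos[OF S, of n X] by (subst ennreal_mult[symmetric]) (auto simp: mult.commute)
  have "risk p n L S \<delta> = (\<integral>\<^sup>+ X. ennreal ?c * lik S X * loss S (\<delta> X) \<partial>\<X>)"
    unfolding risk_def model_def array_normal_def dens by (rule nn_integral_density) measurable
  also have "\<dots> = ennreal ?c * (\<integral>\<^sup>+ X. 1 * (lik S X * loss S (\<delta> X)) \<partial>\<X>)"
    unfolding mult.assoc mult_1 by (rule nn_integral_cmult) measurable
  also have "(\<integral>\<^sup>+ X. 1 * (lik S X * loss S (\<delta> X)) \<partial>\<X>) = base_risk \<delta>"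
    unfolding nn_integral_model_shift[OF S \<delta> borel_measurable_const] by (simp add: base_risk_def)
  finally show ?thesis .
qed

text \<open>
  The weight \<open>\<phi> \<circ> \<delta>\<^sub>0\<close> plays the role of a proper mixing weight over the orbits: its integral
  along each orbit is the same constant, by equivariance and right invariance.
\<close>

lemma base_risk_averaged:
  assumes \<delta>\<^sub>0: "estimator p n \<delta>\<^sub>0" "equivariant p n \<delta>\<^sub>0"
    and \<delta>: "estimator p n \<delta>" "equivariant p n \<delta>"
    and \<phi> [measurable]: "\<phi> \<in> borel_measurable (param_borel p)"
  shows "(\<integral>\<^sup>+ X. \<phi> (\<delta>\<^sub>0 X) * weighted_loss X (\<delta> X) \<partial>\<X>) = (\<integral>\<^sup>+ S. \<phi> S \<partial>haar p) * base_risk \<delta>"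
proof -
  interpret X: sigma_finite_measure \<X> by (rule sigma_finite_array_lebesgue)
  interpret H: sigma_finite_measure "haar p" by (rule sigma_finite_haar)
  interpret XH: pair_sigma_finite \<X> "haar p" ..
  let ?one = "param_one p"
  have \<delta>' [measurable]: "\<delta> \<in> \<X> \<rightarrow>\<^sub>M param_borel p" "\<delta>\<^sub>0 \<in> \<X> \<rightarrow>\<^sub>M param_borel p"
    using \<delta>(1) \<delta>\<^sub>0(1) by (simp_all add: estimator_def)
  have [measurable]: "(\<lambda>_. ?one) \<in> M \<rightarrow>\<^sub>M param_borel p" for M :: "'z measure" by simp
  have haar [measurable]: "(\<lambda>S. S) \<in> haar p \<rightarrow>\<^sub>M param_borel p" by simp
  have [measurable]: "snd \<in> \<X> \<Otimes>\<^sub>M haar p \<rightarrow>\<^sub>M param_borel p"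
    by (rule measurable_compose[OF measurable_snd haar])
  have "(\<integral>\<^sup>+ X. \<phi> (\<delta>\<^sub>0 X) * weighted_loss X (\<delta> X) \<partial>\<X>)
      = (\<integral>\<^sup>+ X. \<integral>\<^sup>+ S. \<phi> (\<delta>\<^sub>0 X) * (lik S X * loss S (\<delta> X)) \<partial>haar p \<partial>\<X>)"
  proof (rule nn_integral_cong)
    fix X assume X: "X \<in> space \<X>"
    then have "\<delta> X \<in> G" using measurable_space[OF \<delta>'(1)] by auto
    with X have [measurable]: "(\<lambda>_. X) \<in> haar p \<rightarrow>\<^sub>M \<X>" "(\<lambda>_. \<delta> X) \<in> haar p \<rightarrow>\<^sub>M param_borel p" by simp_all
    show "\<phi> (\<delta>\<^sub>0 X) * weighted_loss X (\<delta> X) = (\<integral>\<^sup>+ S. \<phi> (\<delta>\<^sub>0 X) * (lik S X * loss S (\<delta> X)) \<partial>haar p)"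
      unfolding weighted_loss_def by (rule nn_integral_cmult[symmetric]) measurable
  qed
  also have "\<dots> = (\<integral>\<^sup>+ S. \<integral>\<^sup>+ X. \<phi> (\<delta>\<^sub>0 X) * (lik S X * loss S (\<delta> X)) \<partial>\<X> \<partial>haar p)"
    by (rule XH.Fubini'[symmetric]) measurable
  also have "\<dots> = (\<integral>\<^sup>+ S. \<integral>\<^sup>+ X. \<phi> (param_mult S (\<delta>\<^sub>0 X)) * (lik ?one X * loss ?one (\<delta> X)) \<partial>\<X> \<partial>haar p)"
  proof (rule nn_integral_cong)
    fix S assume "S \<in> space (haar p)"
    then have S: "S \<in> G" by simp
    have "AE X in \<X>. \<delta>\<^sub>0 (array_act p n S X) = param_mult S (\<delta>\<^sub>0 X)"
      using \<delta>\<^sub>0(2) S by (simp add: equivariant_def)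
    then have *: "AE X in \<X>. \<phi> (\<delta>\<^sub>0 (array_act p n S X)) * (lik ?one X * loss ?one (\<delta> X))
        = \<phi> (param_mult S (\<delta>\<^sub>0 X)) * (lik ?one X * loss ?one (\<delta> X))"
      by eventually_elim simp
    have "(\<integral>\<^sup>+ X. \<phi> (\<delta>\<^sub>0 X) * (lik S X * loss S (\<delta> X)) \<partial>\<X>)
        = (\<integral>\<^sup>+ X. \<phi> (\<delta>\<^sub>0 (array_act p n S X)) * (lik ?one X * loss ?one (\<delta> X)) \<partial>\<X>)"
      by (rule nn_integral_model_shift[OF S \<delta>]) measurable
    also have "\<dots> = (\<integral>\<^sup>+ X. \<phi> (param_mult S (\<delta>\<^sub>0 X)) * (lik ?one X * loss ?one (\<delta> X)) \<partial>\<X>)"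
      by (rule nn_integral_cong_AE[OF *])
    finally show "(\<integral>\<^sup>+ X. \<phi> (\<delta>\<^sub>0 X) * (lik S X * loss S (\<delta> X)) \<partial>\<X>)
        = (\<integral>\<^sup>+ X. \<phi> (param_mult S (\<delta>\<^sub>0 X)) * (lik ?one X * loss ?one (\<delta> X)) \<partial>\<X>)" .
  qed
  also have "\<dots> = (\<integral>\<^sup>+ X. \<integral>\<^sup>+ S. \<phi> (param_mult S (\<delta>\<^sub>0 X)) * (lik ?one X * loss ?one (\<delta> X)) \<partial>haar p \<partial>\<X>)"
    by (rule XH.Fubini') measurable
  also have "\<dots> = (\<integral>\<^sup>+ X. (\<integral>\<^sup>+ S. \<phi> S \<partial>haar p) * (lik ?one X * loss ?one (\<delta> X)) \<partial>\<X>)"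
  proof (rule nn_integral_cong)
    fix X assume "X \<in> space \<X>"
    then have \<delta>0X: "\<delta>\<^sub>0 X \<in> G" using measurable_space[OF \<delta>'(2)] by auto
    then have [measurable]: "(\<lambda>_. \<delta>\<^sub>0 X) \<in> haar p \<rightarrow>\<^sub>M param_borel p" by simp
    have "(\<integral>\<^sup>+ S. \<phi> (param_mult S (\<delta>\<^sub>0 X)) * (lik ?one X * loss ?one (\<delta> X)) \<partial>haar p)
        = (\<integral>\<^sup>+ S. \<phi> (param_mult S (\<delta>\<^sub>0 X)) \<partial>haar p) * (lik ?one X * loss ?one (\<delta> X))"
      by (rule nn_integral_multc) measurable
    then show "(\<integral>\<^sup>+ S. \<phi> (param_mult S (\<delta>\<^sub>0 X)) * (lik ?one X * loss ?one (\<delta> X)) \<partial>haar p)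
        = (\<integral>\<^sup>+ S. \<phi> S \<partial>haar p) * (lik ?one X * loss ?one (\<delta> X))"
      by (simp add: nn_integral_haar_right[OF \<delta>0X \<phi>, symmetric])
  qed
  also have "\<dots> = (\<integral>\<^sup>+ S. \<phi> S \<partial>haar p) * base_risk \<delta>"
    unfolding base_risk_def by (rule nn_integral_cmult) measurable
  finally show ?thesis .
qed

end

lemma invariant_problem_const: "invariant_problem p (\<lambda>_ _. 1)"
  by standard (simp add: invariant_loss_def)

context invariant_problem
begin

lemma evidence_finite:
  assumes \<delta>\<^sub>0: "estimator p n \<delta>\<^sub>0" "equivariant p n \<delta>\<^sub>0"
    and \<phi> [measurable]: "\<phi> \<in> borel_measurable (param_borel p)"
    and fin: "(\<integral>\<^sup>+ S. \<phi> S \<partial>haar p) \<noteq> \<infinity>" and pos: "\<And>S. S \<in> G \<Longrightarrow> 0 < \<phi> S"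
  shows "AE X in \<X>. evidence X \<noteq> \<infinity>"
proof -
  interpret one: invariant_problem p n "\<lambda>_ _. 1" by (rule invariant_problem_const)
  have \<delta>' [measurable]: "\<delta>\<^sub>0 \<in> \<X> \<rightarrow>\<^sub>M param_borel p" using \<delta>\<^sub>0(1) by (simp add: estimator_def)
  interpret H: sigma_finite_measure "haar p" by (rule sigma_finite_haar)
  have haar [measurable]: "(\<lambda>S. S) \<in> haar p \<rightarrow>\<^sub>M param_borel p" by simp
  have [measurable]: "snd \<in> \<X> \<Otimes>\<^sub>M haar p \<rightarrow>\<^sub>M param_borel p"
    by (rule measurable_compose[OF measurable_snd haar])
  have ev: "one.weighted_loss X B = evidence X" for X B
    by (simp add: one.weighted_loss_def evidence_def)
  have "one.base_risk \<delta>\<^sub>0 < \<infinity>"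
    using nn_integral_likelihood_one[of p n] by (simp add: one.base_risk_def)
  then have "(\<integral>\<^sup>+ X. \<phi> (\<delta>\<^sub>0 X) * evidence X \<partial>\<X>) \<noteq> \<infinity>"
    using fin unfolding one.base_risk_averaged[OF \<delta>\<^sub>0 \<delta>\<^sub>0 \<phi>, unfolded ev]
    by (simp add: ennreal_mult_eq_top_iff less_top)
  then have "AE X in \<X>. \<phi> (\<delta>\<^sub>0 X) * evidence X \<noteq> \<infinity>"
    by (intro nn_integral_PInf_AE) (unfold evidence_def, measurable)
  with AE_space show ?thesis
  proof eventually_elim
    case (elim X)
    then have "0 < \<phi> (\<delta>\<^sub>0 X)" using measurable_space[OF \<delta>'] pos by auto
    with elim show ?case by (auto simp: ennreal_mult_eq_top_iff)
  qed
qed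

lemma argmin_base_risk_le:
  assumes \<delta>\<^sub>0: "estimator p n \<delta>\<^sub>0" "equivariant p n \<delta>\<^sub>0"
    and min: "AE X in \<X>. \<delta>\<^sub>0 X \<in> posterior_argmin p n L X"
    and \<delta>: "estimator p n \<delta>" "equivariant p n \<delta>"
  shows "base_risk \<delta>\<^sub>0 \<le> base_risk \<delta>"
proof -
  interpret H: sigma_finite_measure "haar p" by (rule sigma_finite_haar)
  obtain \<phi> where \<phi>: "\<phi> \<in> borel_measurable (haar p)" "(\<integral>\<^sup>+ S. \<phi> S \<partial>haar p) \<noteq> \<infinity>"
    and pos: "\<And>S. S \<in> G \<Longrightarrow> 0 < \<phi> S"
    using H.Ex_finite_integrable_function by auto
  have \<phi>' [measurable]: "\<phi> \<in> borel_measurable (param_borel p)"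
    using \<phi>(1) by (simp add: measurable_cong_sets[OF sets_haar refl])
  have \<delta>' [measurable]: "\<delta> \<in> \<X> \<rightarrow>\<^sub>M param_borel p" "\<delta>\<^sub>0 \<in> \<X> \<rightarrow>\<^sub>M param_borel p"
    using \<delta>(1) \<delta>\<^sub>0(1) by (simp_all add: estimator_def)
  have nonzero: "(\<integral>\<^sup>+ S. \<phi> S \<partial>haar p) \<noteq> 0"
  proof
    assume "(\<integral>\<^sup>+ S. \<phi> S \<partial>haar p) = 0"
    then have "AE S in haar p. \<phi> S = 0"
      using \<phi>(1) by (subst (asm) nn_integral_0_iff_AE) auto
    then have "AE S in haar p. False"
      by (rule AE_mp) (use pos in \<open>force intro!: AE_I2\<close>)
    then have "emeasure (haar p) (space (haar p)) = 0"
      by (simp add: AE_iff_measurable[OF sets.top])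
    then show False using haar_nonzero[of p] by simp
  qed
  have finite: "AE X in \<X>. evidence X \<noteq> \<infinity>"
    by (rule evidence_finite[OF \<delta>\<^sub>0 \<phi>' \<phi>(2)]) (rule pos)
  have "(\<integral>\<^sup>+ X. \<phi> (\<delta>\<^sub>0 X) * weighted_loss X (\<delta>\<^sub>0 X) \<partial>\<X>) \<le> (\<integral>\<^sup>+ X. \<phi> (\<delta>\<^sub>0 X) * weighted_loss X (\<delta> X) \<partial>\<X>)"
  proof (rule nn_integral_mono_AE)
    from AE_space min finite
    show "AE X in \<X>. \<phi> (\<delta>\<^sub>0 X) * weighted_loss X (\<delta>\<^sub>0 X) \<le> \<phi> (\<delta>\<^sub>0 X) * weighted_loss X (\<delta> X)"
    proof eventually_elim
      case (elim X)
      have G: "\<delta> X \<in> G" "\<delta>\<^sub>0 X \<in> G" using elim(1) measurable_space[OF \<delta>'(1)] measurable_space[OF \<delta>'(2)] by auto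
      then have "posterior_loss p n L X (\<delta>\<^sub>0 X) \<le> posterior_loss p n L X (\<delta> X)"
        using elim(2) by (cases "\<delta> X") (auto simp: posterior_argmin_def is_arg_min_def not_less)
      then have "weighted_loss X (\<delta>\<^sub>0 X) / evidence X * evidence X \<le> weighted_loss X (\<delta> X) / evidence X * evidence X"
        by (simp add: posterior_loss_eq[OF elim(1)] G mult_right_mono)
      then have "weighted_loss X (\<delta>\<^sub>0 X) \<le> weighted_loss X (\<delta> X)"
        using evidence_pos[OF elim(1)] elim(3) by (simp add: ennreal_divide_times ennreal_divide_self less_top[symmetric])
      then show ?case by (rule mult_left_mono) simp
    qed
  qed
  then have "(\<integral>\<^sup>+ S. \<phi> S \<partial>haar p) * base_risk \<delta>\<^sub>0 \<le> (\<integral>\<^sup>+ S. \<phi> S \<partial>haar p) * base_risk \<delta>"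
    unfolding base_risk_averaged[OF \<delta>\<^sub>0 \<delta>\<^sub>0 \<phi>'] base_risk_averaged[OF \<delta>\<^sub>0 \<delta> \<phi>'] .
  then show ?thesis
    using nonzero \<phi>(2) by (simp add: ennreal_mult_le_mult_iff)
qed

end

theorem corollary1:
  fixes p :: "nat list" and n :: nat
    and L :: "param \<Rightarrow> param \<Rightarrow> real"
    and \<Sigma>_hat :: "array \<Rightarrow> param"
  assumes "p \<noteq> []" and "\<forall>q\<in>set p. 1 \<le> q" and "1 \<le> n"
    and "invariant_loss p L"
    and "estimator p n \<Sigma>_hat"
    and "AE X in array_lebesgue (p @ [n]). \<Sigma>_hat X \<in> posterior_argmin p n L X"
    and "(AE X in array_lebesgue (p @ [n]). \<exists>!B. B \<in> posterior_argmin p n L X)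
           \<or> equivariant p n \<Sigma>_hat"
  shows "equivariant p n \<Sigma>_hat \<and>
         (\<forall>\<delta>. estimator p n \<delta> \<and> equivariant p n \<delta> \<longrightarrow>
           (\<forall>S\<in>param_group p. risk p n L S \<Sigma>_hat \<le> risk p n L S \<delta>))"
proof -
  interpret invariant_problem p n L by standard fact
  have eq: "equivariant p n \<Sigma>_hat"
    using assms(6,7) unique_argmin_equivariant by blast
  show ?thesis
    using eq assms(5,6)
    by (auto simp: risk_eq intro!: mult_left_mono argmin_base_risk_le)
qed

end
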